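(* Let $\mathcal{G}=(G^0,\mathcal{G}^1,r,s)$ be an ultragraph with at least one edge, let $R$ be a unital commutative ring, and let $\mathbb{F}$ be the free group generated by $\mathcal{G}^1$. Then $L_R(\mathcal{G})$, with its $\mathbb{F}$-grading, is epsilon-strongly $\mathbb{F}$-graded if and only if the ring $L_R(\mathcal{G})$ is unital.
   Context: An ultragraph $\mathcal{G}=(G^0,\mathcal{G}^1,r,s)$ consists of two countable sets $G^0$ (vertices) and $\mathcal{G}^1$ (edges), a map $s:\mathcal{G}^1\to G^0$ and a map $r:\mathcal{G}^1\to P(G^0)\setminus\{\emptyset\}$, where $P(G^0)$ is the power set of $G^0$. $\mathcal{G}^0$ is the smallest subset of $P(G^0)$ that contains $\{v\}$ for all $v\in G^0$, contains $r(e)$ for all $e\in\mathcal{G}^1$, and is closed under finite unions and non-empty finite intersections. For a unital commutative ring $R$, $L_R(\mathcal{G})$ is the universal (not necessarily unital) $R$-algebra with generators $\{s_e,s_e^*:e\in\mathcal{G}^1\}\cup\{p_A:A\in\mathcal{G}^0\}$ and relations: (1) $p_\emptyset=0$, $p_Ap_B=p_{A\cap B}$, $p_{A\cup B}=p_A+p_B-p_{A\cap B}$ for all $A,B\in\mathcal{G}^0$; (2) $p_{s(e)}s_e=s_ep_{r(e)}=s_e$ and $p_{r(e)}s_e^*=s_e^*p_{s(e)}=s_e^*$ for all $e\in\mathcal{G}^1$; (3) $s_e^*s_f=\delta_{e,f}p_{r(e)}$ for all $e,f\in\mathcal{G}^1$; (4) $p_v=\sum_{s(e)=v}s_es_e^*$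 whenever $0<|s^{-1}(v)|<\infty$. Here $p_v$ means $p_{\{v\}}$. A finite path is either an element of $\mathcal{G}^0$ (of length $0$) or a sequence of edges $e_1\cdots e_n$ (of length $n$) with $s(e_{i+1})\in r(e_i)$ for $1\le i<n$. For $\alpha=e_1\cdots e_n$, $s_\alpha=s_{e_1}\cdots s_{e_n}$ and $s_\alpha^*=s_{e_n}^*\cdots s_{e_1}^*$; for $A\in\mathcal{G}^0$, $s_A=s_A^*=p_A$. The $\mathbb{F}$-grading on $L_R(\mathcal{G})$ is the one in which each $p_A$ is homogeneous of degree the neutral element, each $s_e$ is homogeneous of degree $e$, and each $s_e^*$ is homogeneous of degree $e^{-1}$: the component of degree $t\in\mathbb{F}$ is the $R$-span of the elements $s_\alpha p_As_\beta^*$ with $A\in\mathcal{G}^0$ and $\alpha,\beta$ finite paths such that $\alpha\beta^{-1}=t$ in $\mathbb{F}$ (paths of length zero being read as the neutral element). A grading $\{T_g\}_{g\in\Gamma}$ of a ring $T$ by a group $\Gamma$ is epsilon-strong if for each $g\in\Gamma$ the $(T_gT_{g^{-1}},T_{g^{-1}}T_g)$-bimodule $T_g$ is unital; equivalently, for each $g\in\Gamma$ there is $\epsilon_g\in T_gT_{g^{-1}}$ such that $\epsilon_gs=s=s\epsilon_{g^{-1}}$ for all $s\in T_g$. Here $T_gT_h$ denotes the set of finite sums of products. *)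

theory Defs
  imports
    "HOL-Library.Poly_Mapping"
    "HOL-Library.Countable_Set"
    "HOL-Algebra.Module"
    "HOL-Algebra.Ideal_Product"
begin

section \<open>Ultragraphs\<close>

record ('v, 'e) pre_ultragraph =
  verts :: "'v set"
  edges :: "'e set"
  src :: "'e \<Rightarrow> 'v"
  rng :: "'e \<Rightarrow> 'v set"

locale ultragraph =
  fixes G :: "('v, 'e) pre_ultragraph"
  assumes countable_verts: "countable (verts G)"
    and countable_edges: "countable (edges G)"
    and src_in_verts: "e \<in> edges G \<Longrightarrow> src G e \<in> verts G"
    and rng_subset_verts: "e \<in> edges G \<Longrightarrow> rng G e \<subseteq> verts G"
    and rng_nonempty: "e \<in> edges G \<Longrightarrow> rng G e \<noteq> {}"

text \<open>
  The empty union is allowed, so the empty set always belongs to the family below;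
  intersections are taken over nonempty finite subfamilies.
\<close>

inductive_set gen_verts :: "('v, 'e) pre_ultragraph \<Rightarrow> 'v set set"
  for G where
  singleton: "v \<in> verts G \<Longrightarrow> {v} \<in> gen_verts G"
| range: "e \<in> edges G \<Longrightarrow> rng G e \<in> gen_verts G"
| union: "finite \<A> \<Longrightarrow> \<forall>A\<in>\<A>. A \<in> gen_verts G \<Longrightarrow> \<Union>\<A> \<in> gen_verts G"
| inter: "finite \<A> \<Longrightarrow> \<A> \<noteq> {} \<Longrightarrow> \<forall>A\<in>\<A>. A \<in> gen_verts G \<Longrightarrow> \<Inter>\<A> \<in> gen_verts G"

datatype ('v, 'e) fpath = VPath "'v set" | EPath "'e list"

definition finite_paths :: "('v, 'e) pre_ultragraph \<Rightarrow> ('v, 'e) fpath set" where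
  "finite_paths G = VPath ` gen_verts G \<union>
     {EPath es | es. es \<noteq> [] \<and> set es \<subseteq> edges G \<and>
        successively (\<lambda>e f. src G f \<in> rng G e) es}"


section \<open>The free group\<close>

text \<open>
  Elements of the free group on a set are the reduced words; the letter \<open>(x, True)\<close> stands for
  the generator \<open>x\<close> and \<open>(x, False)\<close> for its inverse.
\<close>

definition inv_letter :: "'x \<times> bool \<Rightarrow> 'x \<times> bool" where
  "inv_letter l = (fst l, \<not> snd l)"

definition reduced :: "('x \<times> bool) list \<Rightarrow> bool" where
  "reduced w \<longleftrightarrow> successively (\<lambda>k l. l \<noteq> inv_letter k) w"

fun push_letter :: "'x \<times> bool \<Rightarrow> ('x \<times> bool) list \<Rightarrow> ('x \<times> bool) list" where
  "push_letter l [] = [l]"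
| "push_letter l (k # w) = (if k = inv_letter l then w else l # k # w)"

definition free_group :: "'x set \<Rightarrow> ('x \<times> bool) list monoid" where
  "free_group X = \<lparr>carrier = {w. fst ` set w \<subseteq> X \<and> reduced w},
     monoid.mult = (\<lambda>u v. foldr push_letter u v), one = []\<rparr>"


section \<open>Rings without unit, gradings\<close>

text \<open>
  The ring records of HOL-Algebra are reused for rings that need not have an identity; the field
  \<open>one\<close> of such a record is never referred to.
\<close>

locale nonunital_ring = abelian_group T for T (structure) +
  assumes m_closed: "x \<in> carrier T \<Longrightarrow> y \<in> carrier T \<Longrightarrow> x \<otimes> y \<in> carrier T"
    and m_assoc: "x \<in> carrier T \<Longrightarrow> y \<in> carrier T \<Longrightarrow> z \<in> carrier T \<Longrightarrow>
      (x \<otimes> y) \<otimes> z = x \<otimes> (y \<otimes> z)"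
    and l_distr: "x \<in> carrier T \<Longrightarrow> y \<in> carrier T \<Longrightarrow> z \<in> carrier T \<Longrightarrow>
      (x \<oplus> y) \<otimes> z = x \<otimes> z \<oplus> y \<otimes> z"
    and r_distr: "x \<in> carrier T \<Longrightarrow> y \<in> carrier T \<Longrightarrow> z \<in> carrier T \<Longrightarrow>
      z \<otimes> (x \<oplus> y) = z \<otimes> x \<oplus> z \<otimes> y"

definition unital :: "('a, 'm) ring_scheme \<Rightarrow> bool" where
  "unital T \<longleftrightarrow> (\<exists>u\<in>carrier T. \<forall>x\<in>carrier T. u \<otimes>\<^bsub>T\<^esub> x = x \<and> x \<otimes>\<^bsub>T\<^esub> u = x)"

locale group_grading = group \<Gamma> + nonunital_ring T
  for \<Gamma> :: "('g, 'n) monoid_scheme" and T :: "('a, 'm) ring_scheme" +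
  fixes D :: "'g \<Rightarrow> 'a set"
  assumes component_subgroup: "g \<in> carrier \<Gamma> \<Longrightarrow> subgroup (D g) (add_monoid T)"
    and direct_sum: "x \<in> carrier T \<Longrightarrow>
      \<exists>!c. (\<forall>g\<in>carrier \<Gamma>. c g \<in> D g) \<and> (\<forall>g. g \<notin> carrier \<Gamma> \<longrightarrow> c g = \<zero>\<^bsub>T\<^esub>) \<and>
           finite {g. c g \<noteq> \<zero>\<^bsub>T\<^esub>} \<and> x = (\<Oplus>\<^bsub>T\<^esub>g\<in>{g. c g \<noteq> \<zero>\<^bsub>T\<^esub>}. c g)"
    and component_mult: "g \<in> carrier \<Gamma> \<Longrightarrow> h \<in> carrier \<Gamma> \<Longrightarrow> x \<in> D g \<Longrightarrow> y \<in> D h \<Longrightarrow>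
      x \<otimes>\<^bsub>T\<^esub> y \<in> D (g \<otimes>\<^bsub>\<Gamma>\<^esub> h)"

text \<open>
  For subrings \<open>A\<close>, \<open>B\<close> and an additive subgroup \<open>M\<close> of a ring \<open>T\<close>, with both actions given by
  the multiplication of \<open>T\<close>.
\<close>

definition unital_bimodule :: "('a, 'm) ring_scheme \<Rightarrow> 'a set \<Rightarrow> 'a set \<Rightarrow> 'a set \<Rightarrow> bool" where
  "unital_bimodule T A B M \<longleftrightarrow>
     (\<exists>u\<in>A. \<exists>v\<in>B.
        (\<forall>a\<in>A. u \<otimes>\<^bsub>T\<^esub> a = a \<and> a \<otimes>\<^bsub>T\<^esub> u = a) \<and>
        (\<forall>b\<in>B. v \<otimes>\<^bsub>T\<^esub> b = b \<and> b \<otimes>\<^bsub>T\<^esub> v = b) \<and>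
        (\<forall>m\<in>M. u \<otimes>\<^bsub>T\<^esub> m = m \<and> m \<otimes>\<^bsub>T\<^esub> v = m))"

text \<open>
  \<^const>\<open>ideal_prod\<close> is the set of finite sums of products; its definition does not need the
  factors to be ideals.
\<close>

locale epsilon_strongly_graded = group_grading \<Gamma> T D
  for \<Gamma> :: "('g, 'n) monoid_scheme" and T :: "('a, 'm) ring_scheme" and D :: "'g \<Rightarrow> 'a set" +
  assumes unital_components: "g \<in> carrier \<Gamma> \<Longrightarrow>
    unital_bimodule T (ideal_prod T (D g) (D (inv\<^bsub>\<Gamma>\<^esub> g))) (ideal_prod T (D (inv\<^bsub>\<Gamma>\<^esub> g)) (D g)) (D g)"

text \<open>The description of epsilon-strong gradings by a family of local units:\<close>

context group_grading
begin

lemma component_carrier: "g \<in> carrier \<Gamma> \<Longrightarrow> x \<in> D g \<Longrightarrow> x \<in> carrier T"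
  using subgroup.subset[OF component_subgroup] by auto

lemma ideal_prod_carrier:
  assumes "g \<in> carrier \<Gamma>" "h \<in> carrier \<Gamma>" "x \<in> ideal_prod T (D g) (D h)"
  shows "x \<in> carrier T"
  using assms(3) by induction (auto intro: m_closed component_carrier assms)

lemma ideal_prod_left_unit:
  assumes "g \<in> carrier \<Gamma>" "h \<in> carrier \<Gamma>" "u \<in> carrier T"
    and "\<And>s. s \<in> D g \<Longrightarrow> u \<otimes>\<^bsub>T\<^esub> s = s" "x \<in> ideal_prod T (D g) (D h)"
  shows "u \<otimes>\<^bsub>T\<^esub> x = x"
  using assms(5)
proof induction
  case (prod i j)
  then show ?case using m_assoc[of u i j] assms component_carrier by simp
next
  case (sum s1 s2)
  then show ?case using r_distr[of s1 s2 u] ideal_prod_carrier assms by simp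
qed

lemma ideal_prod_right_unit:
  assumes "g \<in> carrier \<Gamma>" "h \<in> carrier \<Gamma>" "u \<in> carrier T"
    and "\<And>s. s \<in> D h \<Longrightarrow> s \<otimes>\<^bsub>T\<^esub> u = s" "x \<in> ideal_prod T (D g) (D h)"
  shows "x \<otimes>\<^bsub>T\<^esub> u = x"
  using assms(5)
proof induction
  case (prod i j)
  then show ?case using m_assoc[of i j u] assms component_carrier by simp
next
  case (sum s1 s2)
  then show ?case using l_distr[of s1 s2 u] ideal_prod_carrier assms by simp
qed

lemma epsilon_strongly_graded_iff:
  "epsilon_strongly_graded \<Gamma> T D \<longleftrightarrow>
     (\<exists>\<epsilon>. \<forall>g\<in>carrier \<Gamma>. \<epsilon> g \<in> ideal_prod T (D g) (D (inv\<^bsub>\<Gamma>\<^esub> g)) \<and>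
        (\<forall>s\<in>D g. \<epsilon> g \<otimes>\<^bsub>T\<^esub> s = s \<and> s \<otimes>\<^bsub>T\<^esub> \<epsilon> (inv\<^bsub>\<Gamma>\<^esub> g) = s))"
  (is "_ \<longleftrightarrow> (\<exists>\<epsilon>. ?E \<epsilon>)")
proof
  assume "epsilon_strongly_graded \<Gamma> T D"
  then interpret epsilon_strongly_graded \<Gamma> T D .
  let ?P = "\<lambda>g. ideal_prod T (D g) (D (inv\<^bsub>\<Gamma>\<^esub> g))"
  have "\<forall>g\<in>carrier \<Gamma>. \<exists>u. u \<in> ?P g \<and> (\<forall>a\<in>?P g. u \<otimes>\<^bsub>T\<^esub> a = a \<and> a \<otimes>\<^bsub>T\<^esub> u = a) \<and>
      (\<forall>s\<in>D g. u \<otimes>\<^bsub>T\<^esub> s = s)"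
  proof
    fix g assume "g \<in> carrier \<Gamma>"
    from unital_components[OF this] show "\<exists>u. u \<in> ?P g \<and>
        (\<forall>a\<in>?P g. u \<otimes>\<^bsub>T\<^esub> a = a \<and> a \<otimes>\<^bsub>T\<^esub> u = a) \<and> (\<forall>s\<in>D g. u \<otimes>\<^bsub>T\<^esub> s = s)"
      unfolding unital_bimodule_def by (elim bexE) (rule exI, auto)
  qed
  from bchoice[OF this] obtain \<epsilon> where \<epsilon>: "\<And>g. g \<in> carrier \<Gamma> \<Longrightarrow> \<epsilon> g \<in> ?P g"
    "\<And>g a. g \<in> carrier \<Gamma> \<Longrightarrow> a \<in> ?P g \<Longrightarrow> \<epsilon> g \<otimes>\<^bsub>T\<^esub> a = a"
    "\<And>g s. g \<in> carrier \<Gamma> \<Longrightarrow> s \<in> D g \<Longrightarrow> \<epsilon> g \<otimes>\<^bsub>T\<^esub> s = s"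
    by blast
  have "s \<otimes>\<^bsub>T\<^esub> \<epsilon> (inv\<^bsub>\<Gamma>\<^esub> g) = s" if g: "g \<in> carrier \<Gamma>" and s: "s \<in> D g" for g s
  proof -
    have i: "inv\<^bsub>\<Gamma>\<^esub> g \<in> carrier \<Gamma>" "inv\<^bsub>\<Gamma>\<^esub> (inv\<^bsub>\<Gamma>\<^esub> g) = g" using g by auto
    obtain v where v: "v \<in> ?P (inv\<^bsub>\<Gamma>\<^esub> g)" "\<forall>b\<in>?P (inv\<^bsub>\<Gamma>\<^esub> g). b \<otimes>\<^bsub>T\<^esub> v = b" "s \<otimes>\<^bsub>T\<^esub> v = s"
      using unital_components[OF g] s unfolding unital_bimodule_def i(2) by blast
    have "\<epsilon> (inv\<^bsub>\<Gamma>\<^esub> g) = v"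
      using v(2)[rule_format, OF \<epsilon>(1)[OF i(1)]] \<epsilon>(2)[OF i(1) v(1)] by simp
    then show ?thesis using v by simp
  qed
  then show "\<exists>\<epsilon>. ?E \<epsilon>" using \<epsilon>(1,3) by (intro exI[of _ \<epsilon>]) simp
next
  assume "\<exists>\<epsilon>. ?E \<epsilon>"
  then obtain \<epsilon> where \<epsilon>: "?E \<epsilon>" by blast
  show "epsilon_strongly_graded \<Gamma> T D"
  proof (unfold_locales)
    fix g assume g: "g \<in> carrier \<Gamma>"
    then have i: "inv\<^bsub>\<Gamma>\<^esub> g \<in> carrier \<Gamma>" "inv\<^bsub>\<Gamma>\<^esub> (inv\<^bsub>\<Gamma>\<^esub> g) = g" by auto
    have c: "\<epsilon> g \<in> carrier T" "\<epsilon> (inv\<^bsub>\<Gamma>\<^esub> g) \<in> carrier T"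
      using ideal_prod_carrier[OF g i(1)] ideal_prod_carrier[OF i(1) g]
        bspec[OF \<epsilon> g] bspec[OF \<epsilon> i(1)] unfolding i(2) by simp_all
    have l: "\<And>s. s \<in> D g \<Longrightarrow> \<epsilon> g \<otimes>\<^bsub>T\<^esub> s = s" "\<And>s. s \<in> D (inv\<^bsub>\<Gamma>\<^esub> g) \<Longrightarrow> \<epsilon> (inv\<^bsub>\<Gamma>\<^esub> g) \<otimes>\<^bsub>T\<^esub> s = s"
      "\<And>s. s \<in> D g \<Longrightarrow> s \<otimes>\<^bsub>T\<^esub> \<epsilon> (inv\<^bsub>\<Gamma>\<^esub> g) = s" "\<And>s. s \<in> D (inv\<^bsub>\<Gamma>\<^esub> g) \<Longrightarrow> s \<otimes>\<^bsub>T\<^esub> \<epsilon> g = s"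
      using bspec[OF \<epsilon> g] bspec[OF \<epsilon> i(1)] unfolding i(2) by blast+
    show "unital_bimodule T (ideal_prod T (D g) (D (inv\<^bsub>\<Gamma>\<^esub> g)))
        (ideal_prod T (D (inv\<^bsub>\<Gamma>\<^esub> g)) (D g)) (D g)"
      unfolding unital_bimodule_def
    proof (intro bexI conjI ballI)
      show "\<epsilon> g \<in> ideal_prod T (D g) (D (inv\<^bsub>\<Gamma>\<^esub> g))" using \<epsilon> g by blast
      show "\<epsilon> (inv\<^bsub>\<Gamma>\<^esub> g) \<in> ideal_prod T (D (inv\<^bsub>\<Gamma>\<^esub> g)) (D g)"
        using bspec[OF \<epsilon> i(1)] unfolding i(2) by blast
    qed (rule l(1,3) ideal_prod_left_unit[OF g i(1) c(1) l(1)] ideal_prod_right_unit[OF g i(1) c(1) l(4)]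
        ideal_prod_left_unit[OF i(1) g c(2) l(2)] ideal_prod_right_unit[OF i(1) g c(2) l(3)]; assumption)+
  qed
qed

end


section \<open>The Leavitt path algebra of an ultragraph\<close>

text \<open>
  Words over an alphabet form a monoid, so that \<open>'x list \<Rightarrow>\<^sub>0 'r\<close> with its convolution product is
  the free unital algebra on the alphabet.
\<close>

instantiation list :: (type) monoid_add
begin

definition zero_list :: "'a list" where "0 = []"

definition plus_list :: "'a list \<Rightarrow> 'a list \<Rightarrow> 'a list" where "u + v = u @ v"

instance by standard (simp_all add: zero_list_def plus_list_def)

end

datatype ('v, 'e) generator = Vgen "'v set" | Egen 'e | Egen_star 'e

definition generators :: "('v, 'e) pre_ultragraph \<Rightarrow> ('v, 'e) generator set" where
  "generators G = Vgen ` gen_verts G \<union> Egen ` edges G \<union> Egen_star ` edges G"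

text \<open>
  The coefficients range over the sort \<open>{comm_ring, comm_monoid_mult}\<close>, that is, over all
  commutative rings with identity; unlike \<open>comm_ring_1\<close> this includes the zero ring.

  The free algebra without identity consists of the elements in which the empty word does not
  occur.
\<close>

definition free_algebra ::
    "'x set \<Rightarrow> ('x list \<Rightarrow>\<^sub>0 'r::{comm_ring, comm_monoid_mult}) set" where
  "free_algebra X = {a. \<forall>w\<in>Poly_Mapping.keys a. w \<noteq> [] \<and> set w \<subseteq> X}"

definition gen :: "'x \<Rightarrow> 'x list \<Rightarrow>\<^sub>0 'r::{comm_ring, comm_monoid_mult}" where
  "gen x = Poly_Mapping.single [x] 1"

definition scale :: "'r \<Rightarrow> ('x list \<Rightarrow>\<^sub>0 'r) \<Rightarrow> 'x list \<Rightarrow>\<^sub>0 'r::{comm_ring, comm_monoid_mult}" where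
  "scale r a = Poly_Mapping.single [] r * a"

text \<open>A relation \<open>a = b\<close> is represented by the element \<open>a - b\<close>.\<close>

inductive_set relators ::
    "('v, 'e) pre_ultragraph \<Rightarrow>
     (('v, 'e) generator list \<Rightarrow>\<^sub>0 'r::{comm_ring, comm_monoid_mult}) set"
  for G where
  P_empty: "gen (Vgen {}) \<in> relators G"
| P_inter: "A \<in> gen_verts G \<Longrightarrow> B \<in> gen_verts G \<Longrightarrow>
    gen (Vgen A) * gen (Vgen B) - gen (Vgen (A \<inter> B)) \<in> relators G"
| P_union: "A \<in> gen_verts G \<Longrightarrow> B \<in> gen_verts G \<Longrightarrow>
    gen (Vgen (A \<union> B)) - (gen (Vgen A) + gen (Vgen B) - gen (Vgen (A \<inter> B))) \<in> relators G"
| src_S: "e \<in> edges G \<Longrightarrow> gen (Vgen {src G e}) * gen (Egen e) - gen (Egen e) \<in> relators G"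
| S_rng: "e \<in> edges G \<Longrightarrow> gen (Egen e) * gen (Vgen (rng G e)) - gen (Egen e) \<in> relators G"
| rng_S_star: "e \<in> edges G \<Longrightarrow>
    gen (Vgen (rng G e)) * gen (Egen_star e) - gen (Egen_star e) \<in> relators G"
| S_star_src: "e \<in> edges G \<Longrightarrow>
    gen (Egen_star e) * gen (Vgen {src G e}) - gen (Egen_star e) \<in> relators G"
| S_star_S: "e \<in> edges G \<Longrightarrow> f \<in> edges G \<Longrightarrow>
    gen (Egen_star e) * gen (Egen f) - (if e = f then gen (Vgen (rng G e)) else 0) \<in> relators G"
| P_vertex: "v \<in> verts G \<Longrightarrow> finite {e \<in> edges G. src G e = v} \<Longrightarrow>
    {e \<in> edges G. src G e = v} \<noteq> {} \<Longrightarrow>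
    gen (Vgen {v}) - (\<Sum>e\<in>{e \<in> edges G. src G e = v}. gen (Egen e) * gen (Egen_star e)) \<in> relators G"

inductive_set relator_ideal ::
    "('v, 'e) pre_ultragraph \<Rightarrow>
     (('v, 'e) generator list \<Rightarrow>\<^sub>0 'r::{comm_ring, comm_monoid_mult}) set"
  for G where
  relator: "a \<in> relators G \<Longrightarrow> a \<in> relator_ideal G"
| zero: "0 \<in> relator_ideal G"
| add: "a \<in> relator_ideal G \<Longrightarrow> b \<in> relator_ideal G \<Longrightarrow> a + b \<in> relator_ideal G"
| scale: "a \<in> relator_ideal G \<Longrightarrow> scale r a \<in> relator_ideal G"
| mult_left: "b \<in> free_algebra (generators G) \<Longrightarrow> a \<in> relator_ideal G \<Longrightarrow>
    b * a \<in> relator_ideal G"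
| mult_right: "b \<in> free_algebra (generators G) \<Longrightarrow> a \<in> relator_ideal G \<Longrightarrow>
    a * b \<in> relator_ideal G"

definition lpa_class ::
    "('v, 'e) pre_ultragraph \<Rightarrow>
     (('v, 'e) generator list \<Rightarrow>\<^sub>0 'r::{comm_ring, comm_monoid_mult}) \<Rightarrow>
     (('v, 'e) generator list \<Rightarrow>\<^sub>0 'r) set" where
  "lpa_class G a = (\<lambda>x. a + x) ` relator_ideal G"

text \<open>
  The quotient of the free algebra without identity by the ideal of relators, hence the universal
  not necessarily unital algebra satisfying the relations. The type argument is the coefficient
  ring.
\<close>

definition leavitt_path_algebra ::
    "'r::{comm_ring, comm_monoid_mult} itself \<Rightarrow> ('v, 'e) pre_ultragraph \<Rightarrow>
     ('r, (('v, 'e) generator list \<Rightarrow>\<^sub>0 'r) set) module" where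
  "leavitt_path_algebra R G =
     \<lparr>carrier = lpa_class G ` free_algebra (generators G),
      monoid.mult = (\<lambda>X Y. \<Union>a\<in>X. \<Union>b\<in>Y. lpa_class G (a * b)),
      one = undefined,
      ring.zero = lpa_class G 0,
      ring.add = (\<lambda>X Y. \<Union>a\<in>X. \<Union>b\<in>Y. lpa_class G (a + b)),
      smult = (\<lambda>r X. \<Union>a\<in>X. lpa_class G (scale r a))\<rparr>"

definition lpa_gen ::
    "('v, 'e) pre_ultragraph \<Rightarrow> ('v, 'e) generator \<Rightarrow>
     (('v, 'e) generator list \<Rightarrow>\<^sub>0 'r::{comm_ring, comm_monoid_mult}) set" where
  "lpa_gen G x = lpa_class G (gen x)"

text \<open>Products of nonempty lists, as there is no identity to start from.\<close>

fun mult_list :: "('a, 'm) monoid_scheme \<Rightarrow> 'a list \<Rightarrow> 'a" where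
  "mult_list M [x] = x"
| "mult_list M (x # y # xs) = x \<otimes>\<^bsub>M\<^esub> mult_list M (y # xs)"
| "mult_list M [] = undefined"

fun path_elem ::
    "'r::{comm_ring, comm_monoid_mult} itself \<Rightarrow> ('v, 'e) pre_ultragraph \<Rightarrow> ('v, 'e) fpath \<Rightarrow>
     (('v, 'e) generator list \<Rightarrow>\<^sub>0 'r) set" where
  "path_elem R G (VPath A) = lpa_gen G (Vgen A)"
| "path_elem R G (EPath es) =
     mult_list (leavitt_path_algebra R G) (map (\<lambda>e. lpa_gen G (Egen e)) es)"

fun path_elem_star ::
    "'r::{comm_ring, comm_monoid_mult} itself \<Rightarrow> ('v, 'e) pre_ultragraph \<Rightarrow> ('v, 'e) fpath \<Rightarrow>
     (('v, 'e) generator list \<Rightarrow>\<^sub>0 'r) set" where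
  "path_elem_star R G (VPath A) = lpa_gen G (Vgen A)"
| "path_elem_star R G (EPath es) =
     mult_list (leavitt_path_algebra R G) (map (\<lambda>e. lpa_gen G (Egen_star e)) (rev es))"

fun path_degree :: "('v, 'e) fpath \<Rightarrow> ('e \<times> bool) list" where
  "path_degree (VPath A) = []"
| "path_degree (EPath es) = map (\<lambda>e. (e, True)) es"

inductive_set linear_span :: "('r, 'a, 'm) module_scheme \<Rightarrow> 'a set \<Rightarrow> 'a set"
  for M X where
  zero: "\<zero>\<^bsub>M\<^esub> \<in> linear_span M X"
| add: "x \<in> X \<Longrightarrow> y \<in> linear_span M X \<Longrightarrow> (r \<odot>\<^bsub>M\<^esub> x) \<oplus>\<^bsub>M\<^esub> y \<in> linear_span M X"

definition lpa_component ::
    "'r::{comm_ring, comm_monoid_mult} itself \<Rightarrow> ('v, 'e) pre_ultragraph \<Rightarrow>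
     ('e \<times> bool) list \<Rightarrow> (('v, 'e) generator list \<Rightarrow>\<^sub>0 'r) set set" where
  "lpa_component R G t =
     (let F = free_group (edges G); L = leavitt_path_algebra R G in
      linear_span L
        {path_elem R G \<alpha> \<otimes>\<^bsub>L\<^esub> lpa_gen G (Vgen A) \<otimes>\<^bsub>L\<^esub> path_elem_star R G \<beta> | \<alpha> A \<beta>.
           \<alpha> \<in> finite_paths G \<and> A \<in> gen_verts G \<and> \<beta> \<in> finite_paths G \<and>
           path_degree \<alpha> \<otimes>\<^bsub>F\<^esub> inv\<^bsub>F\<^esub> path_degree \<beta> = t})"

end

theory Submission
  imports Defs
begin

text \<open>
  The free algebra is graded by the free group and the relators are homogeneous, so the quotient is
  graded; pushing letters from the left rewrites every word to one of the form
  \<open>s\<^sub>\<alpha> p\<^sub>A s\<^sub>\<beta>\<^sup>*\<close> (or to zero) without changing its degree, which identifies the components.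

  The neutral component contains all \<open>p\<^sub>A\<close>, and these are local units; so its unit, if there is one,
  is a unit of the algebra. Conversely, a unit of the algebra is absorbed by some \<open>p\<^sub>X\<close> and hence
  equals it. If \<open>t = \<alpha>\<beta>\<inverse>\<close> is reduced, then every \<open>s\<^sub>\<mu> p\<^sub>A s\<^sub>\<nu>\<^sup>*\<close> of degree \<open>t\<close> has \<open>\<mu> = \<alpha>\<gamma>\<close> and
  \<open>\<nu> = \<beta>\<gamma>\<close>, and \<open>\<epsilon>\<^sub>t = s\<^sub>\<alpha> p\<^bsub>r(\<alpha>) \<inter> r(\<beta>)\<^esub> s\<^sub>\<alpha>\<^sup>*\<close> works, where \<open>X\<close> plays the role of the range
  of a path of length zero; components of all other degrees vanish.
\<close>

section \<open>The free group\<close>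

lemma inv_letter_inv_letter [simp]: "inv_letter (inv_letter l) = l"
  by (simp add: inv_letter_def)

lemma reduced_Nil [simp]: "reduced []"
  by (simp add: reduced_def)

lemma reduced_ConsD: "reduced (l # w) \<Longrightarrow> reduced w"
  by (cases w) (auto simp: reduced_def)

lemma reduced_Cons_Cons [simp]: "reduced (l # k # w) \<longleftrightarrow> k \<noteq> inv_letter l \<and> reduced (k # w)"
  by (simp add: reduced_def)

lemma reduced_push: "reduced w \<Longrightarrow> reduced (push_letter l w)"
  by (cases w) (auto simp: reduced_def dest: reduced_ConsD[unfolded reduced_def])

lemma reduced_foldr_push: "reduced w \<Longrightarrow> reduced (foldr push_letter u w)"
  by (induction u) (auto intro: reduced_push)

lemma push_reduced: "reduced (l # w) \<Longrightarrow> push_letter l w = l # w"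
  by (cases w) auto

lemma foldr_push_reduced: "reduced w \<Longrightarrow> foldr push_letter w [] = w"
  by (induction w) (auto simp: push_reduced reduced_ConsD)

lemma foldr_push_append_reduced: "reduced (u @ w) \<Longrightarrow> foldr push_letter u w = u @ w"
  by (induction u) (auto simp: push_reduced reduced_ConsD)

text \<open>If pushing \<open>inv_letter l\<close> cancels the head of \<open>w\<close>, that head
  is \<open>l\<close>, and reducedness keeps \<open>l\<close> from cancelling against the next
  letter when it is pushed back. Otherwise the second push just undoes the first.\<close>

lemma push_inv_push:
  assumes "reduced w"
  shows "push_letter l (push_letter (inv_letter l) w) = w"
proof (cases w)
  case (Cons k v)
  then show ?thesis
    using assms push_reduced[of l v] by (cases v) auto
qed simp

lemma push_push_inv: "reduced w \<Longrightarrow> push_letter (inv_letter l) (push_letter l w) = w"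
  using push_inv_push[of w "inv_letter l"] by simp

text \<open>The letters act on reduced words, a letter and its inverse by mutually inverse maps. So
  cancelling such a pair inside the acting word does not change its action; this is the inductive
  step of associativity.\<close>

lemma foldr_push_push:
  assumes "reduced w"
  shows "foldr push_letter (push_letter l v) w = push_letter l (foldr push_letter v w)"
  using push_inv_push[OF reduced_foldr_push[OF assms]] by (cases v) auto

lemma foldr_push_assoc:
  "reduced w \<Longrightarrow>
    foldr push_letter (foldr push_letter u v) w = foldr push_letter u (foldr push_letter v w)"
  by (induction u) (auto simp: foldr_push_push)

lemma foldr_push_inv:
  "reduced w \<Longrightarrow> foldr push_letter (rev (map inv_letter u)) (foldr push_letter u w) = w"
  by (induction u) (auto simp: push_push_inv reduced_foldr_push)

lemma set_push: "set (push_letter l w) \<subseteq> insert l (set w)"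
  by (cases w) auto

lemma set_foldr_push: "set (foldr push_letter u w) \<subseteq> set u \<union> set w"
  by (induction u) (use set_push in fastforce)+

lemma reduced_rev_inv:
  assumes "reduced w"
  shows "reduced (rev (map inv_letter w))"
proof -
  have "successively (\<lambda>k l. inv_letter k \<noteq> l) w"
    using assms unfolding reduced_def by (auto elim: successively_mono)
  then show ?thesis
    unfolding reduced_def successively_rev successively_map
    by (auto elim!: successively_mono dest: arg_cong[of _ _ inv_letter])
qed

section \<open>The group of reduced words and its inverses\<close>

lemma free_group_simps [simp]:
  "w \<in> carrier (free_group X) \<longleftrightarrow> fst ` set w \<subseteq> X \<and> reduced w"
  "u \<otimes>\<^bsub>free_group X\<^esub> v = foldr push_letter u v"
  "\<one>\<^bsub>free_group X\<^esub> = []"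
  by (simp_all add: free_group_def)

lemma rev_inv_in_free_group:
  "w \<in> carrier (free_group X) \<Longrightarrow> rev (map inv_letter w) \<in> carrier (free_group X)"
  by (auto simp: reduced_rev_inv inv_letter_def image_image)

lemma group_free_group: "group (free_group X)"
proof (rule groupI)
  fix x y assume "x \<in> carrier (free_group X)" "y \<in> carrier (free_group X)"
  then show "x \<otimes>\<^bsub>free_group X\<^esub> y \<in> carrier (free_group X)"
    using set_foldr_push[of x y] by (auto simp: reduced_foldr_push image_subset_iff)
next
  fix x assume x: "x \<in> carrier (free_group X)"
  then have "rev (map inv_letter x) \<otimes>\<^bsub>free_group X\<^esub> x = \<one>\<^bsub>free_group X\<^esub>"
    using foldr_push_inv[of "[]" x] by (simp add: foldr_push_reduced)
  then show "\<exists>y\<in>carrier (free_group X). y \<otimes>\<^bsub>free_group X\<^esub> x = \<one>\<^bsub>free_group X\<^esub>"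
    using rev_inv_in_free_group[OF x] by blast
qed (auto simp: foldr_push_assoc)

lemma inv_free_group:
  assumes "w \<in> carrier (free_group X)"
  shows "inv\<^bsub>free_group X\<^esub> w = rev (map inv_letter w)"
proof -
  interpret group "free_group X" by (rule group_free_group)
  have "rev (map inv_letter w) \<otimes>\<^bsub>free_group X\<^esub> w = \<one>\<^bsub>free_group X\<^esub>"
    using assms foldr_push_inv[of "[]" w] by (simp add: foldr_push_reduced)
  then show ?thesis
    using inv_equality assms rev_inv_in_free_group by blast
qed

section \<open>Words \<alpha>\<beta>\<inverse> and their reduced forms\<close>

definition pos :: "'x list \<Rightarrow> ('x \<times> bool) list" where
  "pos as = map (\<lambda>x. (x, True)) as"

definition neg :: "'x list \<Rightarrow> ('x \<times> bool) list" where
  "neg bs = map (\<lambda>x. (x, False)) (rev bs)"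

lemma pos_simps [simp]: "pos [] = []" "pos (a # as) = (a, True) # pos as" "pos (as @ cs) = pos as @ pos cs"
  by (simp_all add: pos_def)

lemma neg_simps [simp]: "neg [] = []" "neg (b # bs) = neg bs @ [(b, False)]" "neg (bs @ cs) = neg cs @ neg bs"
  by (simp_all add: neg_def)

lemma rev_inv_pos: "rev (map inv_letter (pos as)) = neg as"
  by (simp add: pos_def neg_def inv_letter_def rev_map)

lemma reduced_pos: "reduced (pos as)"
  by (induction as rule: induct_list012) (auto simp: inv_letter_def reduced_def)

lemma reduced_neg: "reduced (neg as)"
  using reduced_rev_inv[OF reduced_pos[of as]] by (simp add: rev_inv_pos)

text \<open>The only place where \<open>pos as @ neg bs\<close> can fail to be reduced is the
  junction, where the last edge of \<open>as\<close> meets the inverse of the last edge of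
  \<open>bs\<close>.\<close>

definition no_common_last :: "'x list \<Rightarrow> 'x list \<Rightarrow> bool" where
  "no_common_last as bs \<longleftrightarrow> as = [] \<or> bs = [] \<or> last as \<noteq> last bs"

lemma no_common_last_commute: "no_common_last as bs \<longleftrightarrow> no_common_last bs as"
  by (auto simp: no_common_last_def)

lemma reduced_append:
  "reduced (u @ w) \<longleftrightarrow> reduced u \<and> reduced w \<and> (u = [] \<or> w = [] \<or> hd w \<noteq> inv_letter (last u))"
  by (auto simp: reduced_def successively_append_iff)

lemma reduced_pos_neg:
  assumes "no_common_last as bs"
  shows "reduced (pos as @ neg bs)"
  using assms unfolding reduced_append no_common_last_def
  by (auto simp: reduced_pos reduced_neg)
     (auto simp: pos_def neg_def hd_map hd_rev last_map inv_letter_def)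

text \<open>Common last edges are stripped off until the last edges differ or one list is exhausted.
  The suffix \<open>cs\<close> is the path \<gamma> shared by \<mu> = \<alpha>\<gamma> and \<nu> =
  \<beta>\<gamma>.\<close>

lemma split_common_suffix:
  "\<exists>as0 bs0 cs. as = as0 @ cs \<and> bs = bs0 @ cs \<and> no_common_last as0 bs0"
proof (induction as arbitrary: bs rule: rev_induct)
  case Nil
  then show ?case by (auto simp: no_common_last_def)
next
  case (snoc x as)
  show ?case
  proof (cases "bs \<noteq> [] \<and> last bs = x")
    case True
    then obtain bs' where bs: "bs = bs' @ [x]" by (metis append_butlast_last_id)
    obtain as0 bs0 cs where "as = as0 @ cs" "bs' = bs0 @ cs" "no_common_last as0 bs0"
      using snoc by blast
    with bs show ?thesis by (intro exI[of _ as0] exI[of _ bs0] exI[of _ "cs @ [x]"]) simp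
  next
    case False
    then show ?thesis
      by (intro exI[of _ "as @ [x]"] exI[of _ bs] exI[of _ "[]"]) (auto simp: no_common_last_def)
  qed
qed

text \<open>The product is \<alpha>\<gamma>\<gamma>\<inverse>\<beta>\<inverse>; the two middle
  factors cancel and what remains is already reduced.\<close>

lemma foldr_push_pos_neg:
  assumes "no_common_last as bs"
  shows "foldr push_letter (pos (as @ cs)) (neg (bs @ cs)) = pos as @ neg bs"
proof -
  have "neg (bs @ cs) = foldr push_letter (neg cs) (neg bs)"
    using foldr_push_append_reduced[of "neg cs" "neg bs"] reduced_neg[of "bs @ cs"] by simp
  moreover have "foldr push_letter (pos cs) (foldr push_letter (neg cs) (neg bs)) = neg bs"
    using foldr_push_inv[OF reduced_neg, of "neg cs" bs]
    by (simp add: pos_def neg_def rev_map inv_letter_def comp_def)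
  ultimately show ?thesis
    using foldr_push_append_reduced[OF reduced_pos_neg[OF assms]] by simp
qed

text \<open>The signs of the letters separate the two paths. Hence a degree determines \<alpha> and
  \<beta>, which makes the later choice of a local unit well defined.\<close>

lemma pos_neg_inject: "pos as @ neg bs = pos as' @ neg bs' \<Longrightarrow> as = as' \<and> bs = bs'"
proof -
  assume eq: "pos as @ neg bs = pos as' @ neg bs'"
  have "filter snd (pos as @ neg bs) = pos as" "filter (Not \<circ> snd) (pos as @ neg bs) = neg bs" for as bs :: "'a list"
    by (auto simp: pos_def neg_def filter_map comp_def)
  with eq have "pos as = pos as'" "neg bs = neg bs'" by metis+
  then have "map fst (pos as) = map fst (pos as')" "map fst (neg bs) = map fst (neg bs')" by simp_all
  then show ?thesis by (simp add: pos_def neg_def comp_def)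
qed

section \<open>The quotient algebra\<close>

lemma lookup_scale: "Poly_Mapping.lookup (scale r a) w = r * Poly_Mapping.lookup a w"
proof -
  have "scale r a = Poly_Mapping.map ((*) r) a"
    by (simp add: scale_def mult_map_scale_conv_mult zero_list_def)
  then show ?thesis by (simp add: map.rep_eq when_def)
qed

lemma scale_one [simp]: "scale 1 a = a"
  by (rule poly_mapping_eqI) (simp add: lookup_scale)

lemma scale_minus_one: "scale (- 1) a = - a"
  by (rule poly_mapping_eqI) (simp add: lookup_scale)

lemma scale_add: "scale r (a + b) = scale r a + scale r b"
  by (simp add: scale_def distrib_left)

lemma scale_diff: "scale r (a - b) = scale r a - scale r b"
  by (simp add: scale_def right_diff_distrib)

lemma scale_single [simp]: "scale r (Poly_Mapping.single w s) = Poly_Mapping.single w (r * s)"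
  by (simp add: scale_def mult_single plus_list_def)

lemma scale_mult_left: "scale r (a * b) = scale r a * b"
  by (simp add: scale_def mult.assoc)

text \<open>\<open>scale\<close> multiplies by a multiple of the empty word from the left. Such
  multiples are central: the empty word is neutral for concatenation and the coefficients
  commute.\<close>

lemma mult_single_Nil:
  fixes a :: "'x list \<Rightarrow>\<^sub>0 'r::{comm_ring, comm_monoid_mult}"
  shows "a * Poly_Mapping.single [] r = scale r a"
proof (induction a rule: update_induct)
  case const
  then show ?case by (simp add: scale_def)
next
  case (update f w s)
  have "Poly_Mapping.update w s f = Poly_Mapping.single w s + f"
    using update by (intro poly_mapping_eqI)
      (auto simp: lookup_update lookup_add lookup_single when_def in_keys_iff)
  then show ?case
    by (simp add: update distrib_right scale_add mult_single plus_list_def mult.commute)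
qed

lemma keys_diff_subset:
  fixes a :: "'x \<Rightarrow>\<^sub>0 'b::ab_group_add"
  shows "Poly_Mapping.keys (a - b) \<subseteq> Poly_Mapping.keys a \<union> Poly_Mapping.keys b"
  by (auto simp: in_keys_iff lookup_minus)

lemma keys_mult_words:
  fixes a b :: "'x list \<Rightarrow>\<^sub>0 'r::semiring_0"
  assumes "w \<in> Poly_Mapping.keys (a * b)"
  obtains u v where "w = u @ v" "u \<in> Poly_Mapping.keys a" "v \<in> Poly_Mapping.keys b"
  using assms keys_mult[of a b] unfolding plus_list_def by blast

lemma zero_in_free_algebra [simp]: "0 \<in> free_algebra X"
  by (simp add: free_algebra_def)

lemma gen_in_free_algebra: "x \<in> X \<Longrightarrow> gen x \<in> free_algebra X"
  by (auto simp: free_algebra_def gen_def in_keys_iff lookup_single when_def split: if_splits)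

lemma single_in_free_algebra:
  "w \<noteq> [] \<Longrightarrow> set w \<subseteq> X \<Longrightarrow> Poly_Mapping.single w r \<in> free_algebra X"
  by (auto simp: free_algebra_def in_keys_iff lookup_single when_def split: if_splits)

lemma add_in_free_algebra: "a \<in> free_algebra X \<Longrightarrow> b \<in> free_algebra X \<Longrightarrow> a + b \<in> free_algebra X"
  using Poly_Mapping.keys_add[of a b] by (fastforce simp: free_algebra_def)

lemma diff_in_free_algebra: "a \<in> free_algebra X \<Longrightarrow> b \<in> free_algebra X \<Longrightarrow> a - b \<in> free_algebra X"
  using keys_diff_subset[of a b] by (fastforce simp: free_algebra_def)

lemma scale_in_free_algebra: "a \<in> free_algebra X \<Longrightarrow> scale r a \<in> free_algebra X"
  by (auto simp: free_algebra_def in_keys_iff lookup_scale)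

lemma uminus_in_free_algebra: "a \<in> free_algebra X \<Longrightarrow> - a \<in> free_algebra X"
  using diff_in_free_algebra[OF zero_in_free_algebra] by fastforce

lemma mult_in_free_algebra:
  assumes "a \<in> free_algebra X" "b \<in> free_algebra X" shows "a * b \<in> free_algebra X"
  unfolding free_algebra_def
proof (intro CollectI ballI)
  fix w assume "w \<in> Poly_Mapping.keys (a * b)"
  then show "w \<noteq> [] \<and> set w \<subseteq> X"
    using assms by (elim keys_mult_words) (auto simp: free_algebra_def)
qed

lemma sum_in_free_algebra:
  "(\<And>i. i \<in> J \<Longrightarrow> f i \<in> free_algebra X) \<Longrightarrow> sum f J \<in> free_algebra X"
  by (induction J rule: infinite_finite_induct) (auto intro: add_in_free_algebra)

lemma poly_mapping_sum_singles:
  "a = (\<Sum>w\<in>Poly_Mapping.keys a. Poly_Mapping.single w (Poly_Mapping.lookup a w))"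
  by (rule poly_mapping_eqI) (auto simp: lookup_sum lookup_single when_def in_keys_iff)

text \<open>The case \<open>single\<close> remembers that the word occurs in \<open>a\<close>, so
  that a property of the support of \<open>a\<close>, such as homogeneity, can be used
  there.\<close>

lemma free_algebra_induct [consumes 1, case_names zero single add]:
  assumes "a \<in> free_algebra X"
    and "P 0"
    and "\<And>w r. w \<noteq> [] \<Longrightarrow> set w \<subseteq> X \<Longrightarrow> w \<in> Poly_Mapping.keys a \<Longrightarrow> P (Poly_Mapping.single w r)"
    and "\<And>b c. b \<in> free_algebra X \<Longrightarrow> c \<in> free_algebra X \<Longrightarrow> P b \<Longrightarrow> P c \<Longrightarrow> P (b + c)"
  shows "P a"
proof -
  \<comment> \<open>The induction runs over subsets of the support of the fixed element
    \<open>a\<close>, which keeps membership in that support available.\<close>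
  have "P (\<Sum>w\<in>W. Poly_Mapping.single w (Poly_Mapping.lookup a w))" if "W \<subseteq> Poly_Mapping.keys a" for W
    using finite_subset[OF that finite_keys] that
  proof (induction W)
    case (insert w W)
    moreover have "\<And>v. v \<in> Poly_Mapping.keys a \<Longrightarrow> v \<noteq> [] \<and> set v \<subseteq> X"
      using assms(1) by (auto simp: free_algebra_def)
    ultimately show ?case
      by (simp, intro assms(3,4) single_in_free_algebra sum_in_free_algebra) auto
  qed (simp add: assms(2))
  from this[OF order_refl] show ?thesis unfolding poly_mapping_sum_singles[of a, symmetric] .
qed

section \<open>The ideal of relations and its cosets\<close>

locale ultragraph_algebra = ultragraph G for G :: "('v, 'e) pre_ultragraph" +
  fixes R :: "'r::{comm_ring, comm_monoid_mult} itself"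
begin

abbreviation L where "L \<equiv> leavitt_path_algebra R G"
abbreviation I :: "(('v, 'e) generator list \<Rightarrow>\<^sub>0 'r) set" where "I \<equiv> relator_ideal G"
abbreviation FA :: "(('v, 'e) generator list \<Rightarrow>\<^sub>0 'r) set" where "FA \<equiv> free_algebra (generators G)"
abbreviation cls :: "(('v, 'e) generator list \<Rightarrow>\<^sub>0 'r) \<Rightarrow> _" where "cls \<equiv> lpa_class G"

lemma empty_in_gen_verts: "{} \<in> gen_verts G"
  using gen_verts.union[of "{}" G] by simp

lemma Un_in_gen_verts: "A \<in> gen_verts G \<Longrightarrow> B \<in> gen_verts G \<Longrightarrow> A \<union> B \<in> gen_verts G"
  using gen_verts.union[of "{A, B}" G] by simp

lemma Int_in_gen_verts: "A \<in> gen_verts G \<Longrightarrow> B \<in> gen_verts G \<Longrightarrow> A \<inter> B \<in> gen_verts G"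
  using gen_verts.inter[of "{A, B}" G] by simp

lemma src_in_gen_verts: "e \<in> edges G \<Longrightarrow> {src G e} \<in> gen_verts G"
  by (intro gen_verts.singleton src_in_verts)

lemma generators_iff [simp]:
  "Vgen A \<in> generators G \<longleftrightarrow> A \<in> gen_verts G"
  "Egen e \<in> generators G \<longleftrightarrow> e \<in> edges G"
  "Egen_star e \<in> generators G \<longleftrightarrow> e \<in> edges G"
  by (auto simp: generators_def)

lemma relators_in_free_algebra: "a \<in> relators G \<Longrightarrow> a \<in> FA"
  by (induction rule: relators.induct)
    (auto intro!: diff_in_free_algebra add_in_free_algebra mult_in_free_algebra gen_in_free_algebra
      sum_in_free_algebra simp: empty_in_gen_verts Un_in_gen_verts Int_in_gen_verts
      src_in_gen_verts gen_verts.intros)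

lemma ideal_in_free_algebra: "a \<in> I \<Longrightarrow> a \<in> FA"
  by (induction rule: relator_ideal.induct)
    (auto intro: relators_in_free_algebra add_in_free_algebra scale_in_free_algebra mult_in_free_algebra)

lemma ideal_uminus: "a \<in> I \<Longrightarrow> - a \<in> I"
  using relator_ideal.scale[of a G "- 1"] by (simp add: scale_minus_one)

lemma ideal_sum: "(\<And>i. i \<in> J \<Longrightarrow> f i \<in> I) \<Longrightarrow> sum f J \<in> I"
  by (induction J rule: infinite_finite_induct) (auto intro: relator_ideal.intros)

lemma cls_self: "a \<in> cls a"
  unfolding lpa_class_def using relator_ideal.zero by force

lemma cls_nonempty [simp]: "cls a \<noteq> {}"
  using cls_self by blast

lemma cls_subset: "a - b \<in> I \<Longrightarrow> cls a \<subseteq> cls b"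
proof
  fix c assume ab: "a - b \<in> I" and "c \<in> cls a"
  then obtain x where x: "x \<in> I" "c = a + x" by (auto simp: lpa_class_def)
  then have "c = b + ((a - b) + x)" by simp
  then show "c \<in> cls b" unfolding lpa_class_def using relator_ideal.add[OF ab x(1)] by (rule image_eqI)
qed

lemma cls_eq_iff: "cls a = cls b \<longleftrightarrow> a - b \<in> I"
proof
  assume "cls a = cls b"
  then obtain x where "x \<in> I" "a = b + x" using cls_self[of a] by (auto simp: lpa_class_def)
  then show "a - b \<in> I" by simp
next
  assume ab: "a - b \<in> I"
  then have "b - a \<in> I" using ideal_uminus[OF ab] by simp
  with ab show "cls a = cls b" by (simp add: cls_subset subset_antisym)
qed

lemma diff_in_ideal: "x \<in> cls a \<Longrightarrow> x - a \<in> I"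
  by (auto simp: lpa_class_def)

text \<open>The operations of the quotient are unions over all representatives; if the resulting
  coset is the same for all of them, the union collapses to that coset.\<close>

lemma UN_cls:
  assumes "\<And>x y. x \<in> cls a \<Longrightarrow> y \<in> cls b \<Longrightarrow> cls (f x y) = cls (f a b)"
  shows "(\<Union>x\<in>cls a. \<Union>y\<in>cls b. cls (f x y)) = cls (f a b)"
proof (intro subset_antisym UN_least)
  show "cls (f a b) \<subseteq> (\<Union>x\<in>cls a. \<Union>y\<in>cls b. cls (f x y))"
    using cls_self[of a] cls_self[of b] by blast
qed (simp add: assms)

lemma L_add: "cls a \<oplus>\<^bsub>L\<^esub> cls b = cls (a + b)"
proof -
  have "cls (x + y) = cls (a + b)" if "x \<in> cls a" "y \<in> cls b" for x y
  proof -
    have "(x - a) + (y - b) \<in> I"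
      using that by (intro relator_ideal.add diff_in_ideal)
    then show ?thesis unfolding cls_eq_iff by (simp add: algebra_simps)
  qed
  from UN_cls[where f = "(+)", OF this] show ?thesis
    by (simp add: leavitt_path_algebra_def)
qed

lemma L_mult:
  assumes "a \<in> FA" "b \<in> FA"
  shows "cls a \<otimes>\<^bsub>L\<^esub> cls b = cls (a * b)"
proof -
  have "cls (x * y) = cls (a * b)" if "x \<in> cls a" "y \<in> cls b" for x y
  proof -
    have I: "x - a \<in> I" "y - b \<in> I" using that by (auto intro: diff_in_ideal)
    \<comment> \<open>The difference is split as
      \<open>x * y - a * b = (x - a) * y + a * (y - b)\<close>. The ideal absorbs only factors from
      \<open>FA\<close>, so the representative \<open>y\<close> must be shown to lie there.\<close>
    then have "y \<in> FA" using add_in_free_algebra[OF ideal_in_free_algebra assms(2), of "y - b"] by simp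
    then have "(x - a) * y + a * (y - b) \<in> I"
      using I assms by (intro relator_ideal.add relator_ideal.mult_left relator_ideal.mult_right)
    then show ?thesis unfolding cls_eq_iff by (simp add: algebra_simps)
  qed
  from UN_cls[where f = "(*)", OF this] show ?thesis
    by (simp add: leavitt_path_algebra_def)
qed

lemma L_smult: "r \<odot>\<^bsub>L\<^esub> cls a = cls (scale r a)"
proof -
  have "cls (scale r x) = cls (scale r a)" if "x \<in> cls a" for x
    using relator_ideal.scale[OF diff_in_ideal[OF that]] unfolding cls_eq_iff by (simp add: scale_diff)
  then show ?thesis
    by (simp add: leavitt_path_algebra_def cong: SUP_cong_simp)
qed

lemma L_zero: "\<zero>\<^bsub>L\<^esub> = cls 0"
  by (simp add: leavitt_path_algebra_def)

lemma L_carrier: "carrier L = cls ` FA"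
  by (simp add: leavitt_path_algebra_def)

lemma L_carrier_cls [intro]: "a \<in> FA \<Longrightarrow> cls a \<in> carrier L"
  by (simp add: L_carrier)

lemma nonunital_ring_L: "nonunital_ring L"
proof (intro nonunital_ring.intro nonunital_ring_axioms.intro abelian_groupI)
  fix x assume "x \<in> carrier L"
  then obtain a where a: "a \<in> FA" "x = cls a" by (auto simp: L_carrier)
  then have "- a \<in> FA" "cls (- a) \<oplus>\<^bsub>L\<^esub> x = \<zero>\<^bsub>L\<^esub>"
    by (auto intro: uminus_in_free_algebra simp: L_add L_zero)
  then show "\<exists>y\<in>carrier L. y \<oplus>\<^bsub>L\<^esub> x = \<zero>\<^bsub>L\<^esub>" by blast
qed (auto simp: L_carrier L_add L_zero L_mult mult_in_free_algebra add_in_free_algebra algebra_simps)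

sublocale nonunital_ring L
  by (rule nonunital_ring_L)

lemma L_finsum:
  assumes "finite J" "\<And>i. i \<in> J \<Longrightarrow> f i \<in> FA"
  shows "(\<Oplus>\<^bsub>L\<^esub>i\<in>J. cls (f i)) = cls (\<Sum>i\<in>J. f i)"
  using assms
proof (induction J)
  case (insert j J)
  then show ?case by (simp add: finsum_insert L_add Pi_iff L_carrier)
qed (simp add: L_zero)

lemma cls_uminus: "a \<in> FA \<Longrightarrow> \<ominus>\<^bsub>L\<^esub> cls a = cls (- a)"
  by (rule minus_equality) (auto intro: uminus_in_free_algebra simp: L_add L_zero)

end

section \<open>Homogeneous elements\<close>

fun letters :: "('v, 'e) generator \<Rightarrow> ('e \<times> bool) list" where
  "letters (Vgen A) = []"
| "letters (Egen e) = [(e, True)]"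
| "letters (Egen_star e) = [(e, False)]"

definition word_degree :: "('v, 'e) generator list \<Rightarrow> ('e \<times> bool) list" where
  "word_degree w = foldr push_letter (concat (map letters w)) []"

lemma reduced_word_degree: "reduced (word_degree w)"
  by (simp add: word_degree_def reduced_foldr_push)

lemma word_degree_simps [simp]:
  "word_degree [] = []"
  "word_degree (Vgen A # w) = word_degree w"
  "word_degree (Egen e # w) = push_letter (e, True) (word_degree w)"
  "word_degree (Egen_star e # w) = push_letter (e, False) (word_degree w)"
  by (simp_all add: word_degree_def)

lemma word_degree_append: "word_degree (u @ v) = foldr push_letter (word_degree u) (word_degree v)"
  by (simp add: word_degree_def foldr_push_assoc reduced_foldr_push)

lemma push_letter_cancel: "reduced w \<Longrightarrow> push_letter (e, False) (push_letter (e, True) w) = w"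
  using push_push_inv[of w "(e, True)"] by (simp add: inv_letter_def)

definition homogeneous ::
    "('e \<times> bool) list \<Rightarrow> (('v, 'e) generator list \<Rightarrow>\<^sub>0 'r::zero) \<Rightarrow> bool" where
  "homogeneous t a \<longleftrightarrow> (\<forall>w\<in>Poly_Mapping.keys a. word_degree w = t)"

lemma homogeneous_zero [simp]: "homogeneous t 0"
  by (simp add: homogeneous_def)

lemma homogeneous_single: "word_degree w = t \<Longrightarrow> homogeneous t (Poly_Mapping.single w r)"
  by (auto simp: homogeneous_def in_keys_iff lookup_single when_def split: if_splits)

lemma homogeneous_add: "homogeneous t a \<Longrightarrow> homogeneous t b \<Longrightarrow> homogeneous t (a + b)"
  using Poly_Mapping.keys_add[of a b] by (fastforce simp: homogeneous_def)

lemma homogeneous_diff: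
  fixes a :: "('v, 'e) generator list \<Rightarrow>\<^sub>0 'r::ab_group_add"
  shows "homogeneous t a \<Longrightarrow> homogeneous t b \<Longrightarrow> homogeneous t (a - b)"
  using keys_diff_subset[of a b] by (fastforce simp: homogeneous_def)

lemma homogeneous_scale: "homogeneous t a \<Longrightarrow> homogeneous t (scale r a)"
  by (auto simp: homogeneous_def in_keys_iff lookup_scale)

lemma homogeneous_sum: "(\<And>i. i \<in> J \<Longrightarrow> homogeneous t (f i)) \<Longrightarrow> homogeneous t (sum f J)"
  by (induction J rule: infinite_finite_induct) (auto intro: homogeneous_add)

lemma homogeneous_mult:
  "homogeneous t a \<Longrightarrow> homogeneous u b \<Longrightarrow> homogeneous (foldr push_letter t u) (a * b)"
  by (auto simp: homogeneous_def word_degree_append elim!: keys_mult_words)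

section \<open>Homogeneous parts of an element\<close>

definition proj ::
    "('e \<times> bool) list \<Rightarrow> (('v, 'e) generator list \<Rightarrow>\<^sub>0 'r::comm_monoid_add) \<Rightarrow>
     ('v, 'e) generator list \<Rightarrow>\<^sub>0 'r" where
  "proj t a = (\<Sum>w\<in>Poly_Mapping.keys a.
     if word_degree w = t then Poly_Mapping.single w (Poly_Mapping.lookup a w) else 0)"

lemma lookup_proj:
  "Poly_Mapping.lookup (proj t a) w = (if word_degree w = t then Poly_Mapping.lookup a w else 0)"
proof -
  have "Poly_Mapping.lookup (proj t a) w = (\<Sum>v\<in>Poly_Mapping.keys a.
      if v = w then (if word_degree w = t then Poly_Mapping.lookup a w else 0) else 0)"
    unfolding proj_def lookup_sum
    by (rule sum.cong) (auto simp: lookup_single when_def)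
  then show ?thesis by (simp add: in_keys_iff)
qed

lemma proj_zero [simp]: "proj t 0 = 0"
  by (simp add: proj_def)

lemma proj_add: "proj t (a + b) = proj t a + proj t b"
  by (rule poly_mapping_eqI) (simp add: lookup_proj lookup_add)

lemma proj_diff:
  fixes a :: "('v, 'e) generator list \<Rightarrow>\<^sub>0 'r::ab_group_add"
  shows "proj t (a - b) = proj t a - proj t b"
  by (rule poly_mapping_eqI) (simp add: lookup_proj lookup_minus)

lemma proj_scale: "proj t (scale r a) = scale r (proj t a)"
  by (rule poly_mapping_eqI) (simp add: lookup_proj lookup_scale)

lemma proj_sum: "proj t (sum f J) = (\<Sum>i\<in>J. proj t (f i))"
  by (induction J rule: infinite_finite_induct) (auto simp: proj_add)

lemma homogeneous_proj: "homogeneous t (proj t a)"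
  by (auto simp: homogeneous_def in_keys_iff lookup_proj split: if_splits)

lemma proj_homogeneous: "homogeneous u a \<Longrightarrow> proj t a = (if t = u then a else 0)"
  by (intro poly_mapping_eqI) (auto simp: homogeneous_def in_keys_iff lookup_proj)

lemma proj_in_free_algebra: "a \<in> free_algebra X \<Longrightarrow> proj t a \<in> free_algebra X"
  by (auto simp: free_algebra_def in_keys_iff lookup_proj split: if_splits)

lemma sum_proj:
  assumes "finite T" "word_degree ` Poly_Mapping.keys a \<subseteq> T"
  shows "a = (\<Sum>t\<in>T. proj t a)"
  using assms by (intro poly_mapping_eqI) (auto simp: lookup_sum lookup_proj in_keys_iff image_subset_iff)

section \<open>The grading passes to the quotient\<close>

context ultragraph_algebra
begin

lemma homogeneous_relator: "a \<in> relators G \<Longrightarrow> \<exists>t. homogeneous t a"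
proof (induction rule: relators.induct)
  case (S_star_S e f)
  show ?case
    \<comment> \<open>For distinct edges the relator is a single word, of degree
      \<open>e\<close>\<inverse>\<open>f\<close>; for equal edges that word has neutral degree, as
      \<open>p\<close> of the range does.\<close>
    by (intro exI[of _ "if e = f then [] else [(e, False), (f, True)]"])
      (auto simp: gen_def mult_single plus_list_def inv_letter_def
        intro!: homogeneous_diff homogeneous_single)
qed (auto simp: gen_def mult_single plus_list_def inv_letter_def
      intro!: exI[of "homogeneous _"] homogeneous_diff homogeneous_add homogeneous_sum homogeneous_single)

text \<open>By linearity \<open>b\<close> may be taken to be a multiple of one word. It then moves
  each homogeneous part of \<open>a\<close> into a single degree, so that projecting the product of
  the two gives the product itself or zero.\<close>

lemma proj_ideal_mult:
  assumes "b \<in> FA" "\<And>t. proj t a \<in> I"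
  shows "proj t (b * a) \<in> I" "proj t (a * b) \<in> I"
proof -
  let ?T = "word_degree ` Poly_Mapping.keys a"
  have a: "a = (\<Sum>u\<in>?T. proj u a)" by (rule sum_proj) auto
  from assms(1) have "proj t (b * a) \<in> I \<and> proj t (a * b) \<in> I"
  proof (induction b rule: free_algebra_induct)
    case (single w r)
    let ?s = "Poly_Mapping.single w r :: ('v, 'e) generator list \<Rightarrow>\<^sub>0 'r"
    have s: "?s \<in> FA" "homogeneous (word_degree w) ?s"
      using single by (auto intro: single_in_free_algebra homogeneous_single)
    have "?s * a = (\<Sum>u\<in>?T. ?s * proj u a)" "a * ?s = (\<Sum>u\<in>?T. proj u a * ?s)"
      by (metis a sum_distrib_left, metis a sum_distrib_right)
    moreover have "proj t (?s * proj u a) \<in> I" "proj t (proj u a * ?s) \<in> I" for u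
      unfolding proj_homogeneous[OF homogeneous_mult[OF s(2) homogeneous_proj]]
        proj_homogeneous[OF homogeneous_mult[OF homogeneous_proj s(2)]]
      using assms(2)[of u] s(1)
      by (auto intro: relator_ideal.zero relator_ideal.mult_left relator_ideal.mult_right)
    ultimately show ?case by (simp add: proj_sum ideal_sum)
  qed (auto simp: distrib_left distrib_right proj_add intro: relator_ideal.zero relator_ideal.add)
  then show "proj t (b * a) \<in> I" "proj t (a * b) \<in> I" by auto
qed

text \<open>An ideal generated by homogeneous elements contains the homogeneous parts of its
  elements. Uniqueness of the decomposition in the quotient rests on this.\<close>

lemma proj_ideal: "a \<in> I \<Longrightarrow> proj t a \<in> I"
proof (induction arbitrary: t rule: relator_ideal.induct)
  case (relator a)
  then obtain u where "homogeneous u a" using homogeneous_relator by blast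
  then show ?case
    using relator by (auto simp: proj_homogeneous intro: relator_ideal.relator relator_ideal.zero)
qed (auto simp: proj_add proj_scale proj_ideal_mult
      intro: relator_ideal.zero relator_ideal.add relator_ideal.scale)

definition homs :: "('e \<times> bool) list \<Rightarrow> (('v, 'e) generator list \<Rightarrow>\<^sub>0 'r) set" where
  "homs t = {a \<in> FA. homogeneous t a}"

lemma word_degree_in_free_group:
  "set w \<subseteq> generators G \<Longrightarrow> word_degree w \<in> carrier (free_group (edges G))"
proof (induction w)
  case (Cons x w)
  then show ?case
    using set_push[of _ "word_degree w"] by (cases x) (fastforce simp: reduced_push)+
qed simp

lemma degrees_in_free_group:
  "a \<in> FA \<Longrightarrow> word_degree ` Poly_Mapping.keys a \<subseteq> carrier (free_group (edges G))"
  using word_degree_in_free_group by (auto simp: free_algebra_def simp del: free_group_simps)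

lemma group_grading_homs: "group_grading (free_group (edges G)) L (\<lambda>t. cls ` homs t)"
proof (intro group_grading.intro group_free_group nonunital_ring_L group_grading_axioms.intro)
  fix t assume "t \<in> carrier (free_group (edges G))"
  show "subgroup (cls ` homs t) (add_monoid L)"
  proof (rule add.subgroupI)
    fix x assume "x \<in> cls ` homs t"
    then obtain a where a: "a \<in> FA" "homogeneous t a" "x = cls a" by (auto simp: homs_def)
    then have "scale (- 1) a \<in> homs t" by (auto simp: homs_def homogeneous_scale scale_in_free_algebra)
    then show "\<ominus>\<^bsub>L\<^esub> x \<in> cls ` homs t" using a by (simp add: cls_uminus scale_minus_one)
  next
    show "cls ` homs t \<noteq> {}" by (auto simp: homs_def intro: exI[of _ 0])
  qed (auto simp: homs_def L_add homogeneous_add add_in_free_algebra)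
next
  fix x assume "x \<in> carrier L"
  then obtain a where a: "a \<in> FA" "x = cls a" by (auto simp: L_carrier)
  let ?F = "carrier (free_group (edges G))"
  let ?P = "\<lambda>c. (\<forall>g\<in>?F. c g \<in> cls ` homs g) \<and> (\<forall>g. g \<notin> ?F \<longrightarrow> c g = \<zero>\<^bsub>L\<^esub>) \<and>
    finite {g. c g \<noteq> \<zero>\<^bsub>L\<^esub>} \<and> x = (\<Oplus>\<^bsub>L\<^esub>g\<in>{g. c g \<noteq> \<zero>\<^bsub>L\<^esub>}. c g)"
  let ?T = "word_degree ` Poly_Mapping.keys a"
  \<comment> \<open>The components of \<open>x\<close> are the classes of the homogeneous parts of a
    representative; the value outside the free group is the one that \<open>direct_sum\<close>
    prescribes.\<close>
  define c where "c = (\<lambda>g. if g \<in> ?F then cls (proj g a) else \<zero>\<^bsub>L\<^esub>)"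
  have c_outside: "c g = \<zero>\<^bsub>L\<^esub>" if "g \<notin> ?T" for g
  proof -
    have "proj g a = 0" using that by (intro poly_mapping_eqI) (auto simp: lookup_proj in_keys_iff)
    then show ?thesis by (simp add: c_def L_zero)
  qed
  have sub: "{g. c g \<noteq> \<zero>\<^bsub>L\<^esub>} \<subseteq> ?T" using c_outside by blast
  have c_T: "c g = cls (proj g a)" if "g \<in> ?T" for g
    using subsetD[OF degrees_in_free_group[OF a(1)] that] by (simp add: c_def del: free_group_simps)
  have "x = cls (\<Sum>g\<in>?T. proj g a)" using a sum_proj[of ?T a] by simp
  also have "\<dots> = (\<Oplus>\<^bsub>L\<^esub>g\<in>?T. cls (proj g a))"
    using a by (intro L_finsum[symmetric]) (auto intro: proj_in_free_algebra)
  \<comment> \<open>A nonzero homogeneous part of \<open>a\<close> may have class zero, so the index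
    set can shrink when passing from degrees of \<open>a\<close> to nonzero components.\<close>
  also have "\<dots> = (\<Oplus>\<^bsub>L\<^esub>g\<in>{g. c g \<noteq> \<zero>\<^bsub>L\<^esub>}. c g)"
    using a(1) sub c_T
    by (intro add.finprod_mono_neutral_cong_right) (auto simp: L_carrier proj_in_free_algebra)
  finally have P_c: "?P c"
    using finite_subset[OF sub] a(1)
    by (auto simp: c_def homs_def homogeneous_proj proj_in_free_algebra simp del: free_group_simps)
  have c_unique: "d = c" if d: "?P d" for d
  proof
    fix g
    let ?S = "{g. d g \<noteq> \<zero>\<^bsub>L\<^esub>}"
    have S: "?S \<subseteq> ?F" "finite ?S" using d by auto
    \<comment> \<open>Each component of a competing decomposition is lifted to a homogeneous
      element, so that the comparison with \<open>a\<close> takes place in the free algebra.\<close>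
    have "\<forall>h\<in>?F. \<exists>b. b \<in> homs h \<and> d h = cls b" using d by blast
    from bchoice[OF this] obtain f where f: "\<And>h. h \<in> ?F \<Longrightarrow> f h \<in> homs h \<and> d h = cls (f h)" by blast
    have "(\<Oplus>\<^bsub>L\<^esub>g\<in>?S. d g) = (\<Oplus>\<^bsub>L\<^esub>g\<in>?S. cls (f g))"
      using f S by (intro finsum_cong') (auto simp: homs_def L_carrier)
    also have "\<dots> = cls (\<Sum>h\<in>?S. f h)"
      using f S by (intro L_finsum) (auto simp: homs_def)
    finally have "cls a = cls (\<Sum>h\<in>?S. f h)" using d a(2) by simp
    \<comment> \<open>The difference of the two representatives lies in the ideal; its part of
      degree \<open>g\<close> does too, and this part compares the two candidates for the component
      at \<open>g\<close>.\<close>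
    then have "proj g (a - (\<Sum>h\<in>?S. f h)) \<in> I" unfolding cls_eq_iff by (rule proj_ideal)
    then have "cls (proj g a) = cls (\<Sum>h\<in>?S. proj g (f h))"
      unfolding cls_eq_iff by (simp add: proj_diff proj_sum)
    also have "(\<Sum>h\<in>?S. proj g (f h)) = (\<Sum>h\<in>?S. if g = h then f h else 0)"
      using f S by (intro sum.cong proj_homogeneous refl) (auto simp: homs_def)
    finally have "cls (proj g a) = cls (if g \<in> ?S then f g else 0)" using S(2) by simp
    then show "d g = c g"
      using f[of g] d unfolding c_def by (auto simp: L_zero split: if_splits)
  qed
  from P_c c_unique show "\<exists>!c. ?P c" by (rule ex1I)
next
  fix g h x y assume "x \<in> cls ` homs g" "y \<in> cls ` homs h"
  then obtain a b where "a \<in> homs g" "b \<in> homs h" "x = cls a" "y = cls b" by blast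
  then show "x \<otimes>\<^bsub>L\<^esub> y \<in> cls ` homs (g \<otimes>\<^bsub>free_group (edges G)\<^esub> h)"
    by (auto simp: homs_def L_mult intro!: imageI homogeneous_mult mult_in_free_algebra)
qed

section \<open>Monomials\<close>

text \<open>The empty word is allowed, although its class is in general not an element of the
  algebra; this is why words are required to be nonempty when they are multiplied.\<close>

definition mon :: "('v, 'e) generator list \<Rightarrow> (('v, 'e) generator list \<Rightarrow>\<^sub>0 'r) set" where
  "mon w = cls (Poly_Mapping.single w 1)"

lemma mon_closed [intro]: "w \<noteq> [] \<Longrightarrow> set w \<subseteq> generators G \<Longrightarrow> mon w \<in> carrier L"
  by (auto simp: mon_def intro: single_in_free_algebra)

lemma mon_mult:
  "u \<noteq> [] \<Longrightarrow> v \<noteq> [] \<Longrightarrow> set u \<subseteq> generators G \<Longrightarrow> set v \<subseteq> generators G \<Longrightarrow>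
    mon u \<otimes>\<^bsub>L\<^esub> mon v = mon (u @ v)"
  by (simp add: mon_def L_mult single_in_free_algebra mult_single plus_list_def)

lemma smult_mon: "r \<odot>\<^bsub>L\<^esub> mon w = cls (Poly_Mapping.single w r)"
  by (simp add: mon_def L_smult)

text \<open>The empty word is not in \<open>FA\<close>, so empty surroundings are treated apart:
  there the multiplication is scaling by 1.\<close>

lemma ideal_context:
  assumes "a \<in> I" "set x \<subseteq> generators G" "set y \<subseteq> generators G"
  shows "Poly_Mapping.single x 1 * a * Poly_Mapping.single y 1 \<in> I"
proof -
  have "Poly_Mapping.single x 1 * a \<in> I"
    using assms by (cases "x = []")
      (auto simp: scale_def[symmetric] intro: relator_ideal.mult_left single_in_free_algebra)
  then show ?thesis
    using assms by (cases "y = []")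
      (auto simp: mult_single_Nil intro: relator_ideal.mult_right single_in_free_algebra)
qed

lemma mon_context:
  assumes "mon u = mon v" "set x \<subseteq> generators G" "set y \<subseteq> generators G"
  shows "mon (x @ u @ y) = mon (x @ v @ y)"
  using ideal_context[OF _ assms(2,3)] assms(1) unfolding mon_def cls_eq_iff
  by (fastforce simp: right_diff_distrib left_diff_distrib mult_single plus_list_def)

lemma mon_context_zero:
  assumes "mon u = \<zero>\<^bsub>L\<^esub>" "set x \<subseteq> generators G" "set y \<subseteq> generators G"
  shows "mon (x @ u @ y) = \<zero>\<^bsub>L\<^esub>"
  using ideal_context[OF _ assms(2,3)] assms(1) unfolding mon_def L_zero cls_eq_iff
  by (fastforce simp: mult_single plus_list_def)

section \<open>Rewriting rules for words\<close>

lemma mon_relation: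
  "Poly_Mapping.single u (1::'r) - Poly_Mapping.single v 1 \<in> relators G \<Longrightarrow> mon u = mon v"
  "Poly_Mapping.single u (1::'r) \<in> relators G \<Longrightarrow> mon u = \<zero>\<^bsub>L\<^esub>"
  unfolding mon_def L_zero cls_eq_iff by (auto intro: relator_ideal.relator)

lemma mon_PP: "A \<in> gen_verts G \<Longrightarrow> B \<in> gen_verts G \<Longrightarrow> mon [Vgen A, Vgen B] = mon [Vgen (A \<inter> B)]"
  using relators.P_inter[of A G B] by (intro mon_relation) (simp add: gen_def mult_single plus_list_def)

lemma mon_P_empty: "mon [Vgen {}] = \<zero>\<^bsub>L\<^esub>"
  using relators.P_empty[of G] by (intro mon_relation) (simp add: gen_def)

lemma mon_src_S: "e \<in> edges G \<Longrightarrow> mon [Vgen {src G e}, Egen e] = mon [Egen e]"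
  using relators.src_S[of e G] by (intro mon_relation) (simp add: gen_def mult_single plus_list_def)

lemma mon_S_rng: "e \<in> edges G \<Longrightarrow> mon [Egen e, Vgen (rng G e)] = mon [Egen e]"
  using relators.S_rng[of e G] by (intro mon_relation) (simp add: gen_def mult_single plus_list_def)

lemma mon_rng_S_star: "e \<in> edges G \<Longrightarrow> mon [Vgen (rng G e), Egen_star e] = mon [Egen_star e]"
  using relators.rng_S_star[of e G] by (intro mon_relation) (simp add: gen_def mult_single plus_list_def)

lemma mon_S_star_src: "e \<in> edges G \<Longrightarrow> mon [Egen_star e, Vgen {src G e}] = mon [Egen_star e]"
  using relators.S_star_src[of e G] by (intro mon_relation) (simp add: gen_def mult_single plus_list_def)

lemma mon_S_star_S: "e \<in> edges G \<Longrightarrow> mon [Egen_star e, Egen e] = mon [Vgen (rng G e)]"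
  using relators.S_star_S[of e G e] by (intro mon_relation) (simp add: gen_def mult_single plus_list_def)

lemma mon_S_star_S_neq: "e \<in> edges G \<Longrightarrow> f \<in> edges G \<Longrightarrow> e \<noteq> f \<Longrightarrow> mon [Egen_star e, Egen f] = \<zero>\<^bsub>L\<^esub>"
  using relators.S_star_S[of e G f] by (intro mon_relation) (simp add: gen_def mult_single plus_list_def)

text \<open>Writing \<open>s_e = p_{s(e)} s_e\<close> puts two projections side by side, and the
  intersection of \<open>A\<close> with a singleton is that singleton or empty.\<close>

lemma mon_P_S:
  assumes "A \<in> gen_verts G" "e \<in> edges G"
  shows "mon [Vgen A, Egen e] = (if src G e \<in> A then mon [Egen e] else \<zero>\<^bsub>L\<^esub>)"
proof -
  have "mon [Vgen A, Egen e] = mon ([Vgen A, Vgen {src G e}] @ [Egen e])"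
    using mon_context[OF mon_src_S, of e "[Vgen A]" "[]"] assms by simp
  also have "\<dots> = mon ([Vgen (A \<inter> {src G e})] @ [Egen e])"
    using mon_context[OF mon_PP, of A "{src G e}" "[]"] assms src_in_gen_verts by simp
  also have "\<dots> = (if src G e \<in> A then mon [Egen e] else \<zero>\<^bsub>L\<^esub>)"
    using mon_context_zero[OF mon_P_empty, of "[]" "[Egen e]"] mon_src_S assms
    by (auto simp: Int_insert_right)
  finally show ?thesis .
qed

lemma mon_S_star_P:
  assumes "A \<in> gen_verts G" "e \<in> edges G"
  shows "mon [Egen_star e, Vgen A] = (if src G e \<in> A then mon [Egen_star e] else \<zero>\<^bsub>L\<^esub>)"
proof -
  have "mon [Egen_star e, Vgen A] = mon ([Egen_star e] @ [Vgen {src G e}, Vgen A])"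
    using mon_context[OF mon_S_star_src, of e "[]" "[Vgen A]"] assms by simp
  also have "\<dots> = mon ([Egen_star e] @ [Vgen ({src G e} \<inter> A)])"
    using mon_context[OF mon_PP, of "{src G e}" A "[Egen_star e]" "[]"] assms src_in_gen_verts by simp
  also have "\<dots> = (if src G e \<in> A then mon [Egen_star e] else \<zero>\<^bsub>L\<^esub>)"
    using mon_context_zero[OF mon_P_empty, of "[Egen_star e]" "[]"] mon_S_star_src assms
    by (auto simp: Int_insert_left)
  finally show ?thesis .
qed

text \<open>Inserting \<open>p_{r(e)}\<close> between the two edges kills the product, so only
  products along paths survive.\<close>

lemma mon_S_S:
  assumes "e \<in> edges G" "f \<in> edges G" "src G f \<notin> rng G e"
  shows "mon [Egen e, Egen f] = \<zero>\<^bsub>L\<^esub>"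
  using mon_context[OF mon_S_rng, of e "[]" "[Egen f]"] assms
    mon_context_zero[of "[Vgen (rng G e), Egen f]" "[Egen e]" "[]"]
  by (simp add: mon_P_S gen_verts.range)

lemma mon_S_star_S_star:
  assumes "e \<in> edges G" "f \<in> edges G" "src G f \<notin> rng G e"
  shows "mon [Egen_star f, Egen_star e] = \<zero>\<^bsub>L\<^esub>"
  using mon_context[OF mon_rng_S_star, of e "[Egen_star f]" "[]"] assms
    mon_context_zero[of "[Egen_star f, Vgen (rng G e)]" "[]" "[Egen_star e]"]
  by (simp add: mon_S_star_P gen_verts.range)

text \<open>Unlike in \<open>finite_paths\<close>, the empty list is a path here. The vertex set
  that a path of length zero carries there is kept separately, as the middle letter of a normal
  word.\<close>

definition epath :: "'e list \<Rightarrow> bool" where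
  "epath es \<longleftrightarrow> set es \<subseteq> edges G \<and> successively (\<lambda>e f. src G f \<in> rng G e) es"

lemma epath_Nil [simp]: "epath []"
  by (simp add: epath_def)

lemma epath_Cons: "epath (e # es) \<longleftrightarrow> e \<in> edges G \<and> epath es \<and> (es \<noteq> [] \<longrightarrow> src G (hd es) \<in> rng G e)"
  by (cases es) (auto simp: epath_def)

lemma epath_append:
  "epath (as @ bs) \<longleftrightarrow> epath as \<and> epath bs \<and> (as \<noteq> [] \<longrightarrow> bs \<noteq> [] \<longrightarrow> src G (hd bs) \<in> rng G (last as))"
  by (auto simp: epath_def successively_append_iff)

section \<open>Normal words and the reduction to them\<close>

definition edge_word :: "'e list \<Rightarrow> ('v, 'e) generator list" where
  "edge_word as = map Egen as"

definition star_word :: "'e list \<Rightarrow> ('v, 'e) generator list" where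
  "star_word bs = map Egen_star (rev bs)"

lemma edge_star_word_simps [simp]:
  "edge_word [] = []" "edge_word (a # as) = Egen a # edge_word as" "edge_word (as @ cs) = edge_word as @ edge_word cs"
  "star_word [] = []" "star_word (a # as) = star_word as @ [Egen_star a]" "star_word (as @ cs) = star_word cs @ star_word as"
  "set (edge_word as) \<subseteq> generators G \<longleftrightarrow> set as \<subseteq> edges G"
  "set (star_word as) \<subseteq> generators G \<longleftrightarrow> set as \<subseteq> edges G"
  "edge_word as = [] \<longleftrightarrow> as = []" "star_word as = [] \<longleftrightarrow> as = []"
  by (auto simp: edge_word_def star_word_def)

lemma word_degree_edge_word_append: "word_degree (edge_word as @ w) = foldr push_letter (pos as) (word_degree w)"
  by (induction as) simp_all

lemma word_degree_star_word: "word_degree (star_word bs) = neg bs"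
proof -
  have "concat (map letters (star_word bs)) = neg bs"
    by (induction bs) simp_all
  then show ?thesis
    unfolding word_degree_def by (simp add: foldr_push_reduced reduced_neg)
qed

definition normal_word :: "'e list \<Rightarrow> 'v set \<Rightarrow> 'e list \<Rightarrow> ('v, 'e) generator list" where
  "normal_word as A bs = edge_word as @ [Vgen A] @ star_word bs"

lemma word_degree_normal_word: "word_degree (normal_word as A bs) = foldr push_letter (pos as) (neg bs)"
  by (simp add: normal_word_def word_degree_edge_word_append word_degree_star_word)

definition normal_forms :: "('e \<times> bool) list \<Rightarrow> (('v, 'e) generator list \<Rightarrow>\<^sub>0 'r) set set" where
  "normal_forms t = {mon (normal_word as A bs) | as A bs. epath as \<and> epath bs \<and> A \<in> gen_verts G \<and>
     foldr push_letter (pos as) (neg bs) = t}"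

lemma normalI:
  "mon w = mon (normal_word as A bs) \<Longrightarrow> word_degree w = word_degree (normal_word as A bs) \<Longrightarrow>
    epath as \<Longrightarrow> epath bs \<Longrightarrow> A \<in> gen_verts G \<Longrightarrow> mon w \<in> normal_forms (word_degree w)"
  unfolding normal_forms_def mem_Collect_eq
  by (rule exI[of _ as], rule exI[of _ A], rule exI[of _ bs]) (simp add: word_degree_normal_word)

text \<open>If \<open>as\<close> is empty, \<open>p_B\<close> merges with \<open>p_A\<close>;
  otherwise it meets the first edge, which absorbs it or turns the word into zero.\<close>

lemma normal_Vgen_Cons:
  assumes "epath as" "epath bs" "A \<in> gen_verts G" "B \<in> gen_verts G"
  shows "mon (Vgen B # normal_word as A bs) \<in> insert \<zero>\<^bsub>L\<^esub> (normal_forms (word_degree (Vgen B # normal_word as A bs)))"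
proof (cases as)
  case Nil
  have "mon (Vgen B # normal_word as A bs) = mon (normal_word as (B \<inter> A) bs)"
    using Nil assms mon_context[OF mon_PP, of B A "[]" "star_word bs"] by (simp add: normal_word_def epath_def)
  from normalI[OF this] show ?thesis using Nil assms by (simp add: normal_word_def Int_in_gen_verts)
next
  case (Cons e es)
  have "mon (Vgen B # normal_word as A bs) = (if src G e \<in> B then mon (normal_word as A bs) else \<zero>\<^bsub>L\<^esub>)"
    using Cons assms mon_context[of "[Vgen B, Egen e]" "[Egen e]" "[]" "normal_word es A bs"]
      mon_context_zero[of "[Vgen B, Egen e]" "[]" "normal_word es A bs"]
    by (simp add: normal_word_def epath_def mon_P_S)
  then show ?thesis
    using Cons assms normalI[of "Vgen B # normal_word as A bs" as A bs] by (simp add: normal_word_def)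
qed

text \<open>The new edge either prolongs the path at its beginning or is not composable with it, and
  then the word vanishes.\<close>

lemma normal_Egen_Cons:
  assumes "epath as" "epath bs" "A \<in> gen_verts G" "e \<in> edges G"
  shows "mon (Egen e # normal_word as A bs) \<in> insert \<zero>\<^bsub>L\<^esub> (normal_forms (word_degree (Egen e # normal_word as A bs)))"
proof (cases "as = [] \<or> src G (hd as) \<in> rng G e")
  case True
  then have "epath (e # as)" using assms by (auto simp: epath_Cons)
  then show ?thesis
    using assms normalI[of "Egen e # normal_word as A bs" "e # as" A bs] by (simp add: normal_word_def)
next
  case False
  then obtain f fs where as: "as = f # fs" "src G f \<notin> rng G e" by (cases as) auto
  then show ?thesis
    using assms mon_context_zero[OF mon_S_S, of e f "[]" "normal_word fs A bs"] by (simp add: normal_word_def epath_def)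
qed

text \<open>If \<open>as\<close> is empty, \<open>s_e^*\<close> absorbs \<open>p_A\<close> or is
  killed by it, and a surviving star prolongs \<open>bs\<close> at its end or gives zero. If
  \<open>as\<close> begins with an edge \<open>f\<close>, then \<open>s_e^* s_f\<close> is zero or a
  projection, which leads back to \<open>normal_Vgen_Cons\<close>.\<close>

lemma normal_Egen_star_Cons:
  assumes "epath as" "epath bs" "A \<in> gen_verts G" "e \<in> edges G"
  shows "mon (Egen_star e # normal_word as A bs) \<in> insert \<zero>\<^bsub>L\<^esub> (normal_forms (word_degree (Egen_star e # normal_word as A bs)))"
proof (cases as)
  case Nil
  have *: "mon (Egen_star e # normal_word as A bs) = (if src G e \<in> A then mon (Egen_star e # star_word bs) else \<zero>\<^bsub>L\<^esub>)"
    using Nil assms mon_context[of "[Egen_star e, Vgen A]" "[Egen_star e]" "[]" "star_word bs"]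
      mon_context_zero[of "[Egen_star e, Vgen A]" "[]" "star_word bs"]
    by (simp add: normal_word_def epath_def mon_S_star_P)
  show ?thesis
  proof (cases "bs = [] \<or> src G e \<in> rng G (last bs)")
    case True
    \<comment> \<open>After \<open>p_A\<close> has been absorbed the word lacks its middle
      projection; \<open>r(e)\<close> supplies a new one.\<close>
    have "mon (Egen_star e # star_word bs) = mon (normal_word [] (rng G e) (bs @ [e]))"
      using assms mon_context[OF mon_rng_S_star, of e "[]" "star_word bs"] by (simp add: normal_word_def epath_def)
    moreover have "epath (bs @ [e])" using True assms by (auto simp: epath_append epath_Cons)
    ultimately show ?thesis
      using * assms Nil normalI[of "Egen_star e # normal_word as A bs" "[]" "rng G e" "bs @ [e]"]
      by (simp add: gen_verts.range normal_word_def)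
  next
    case False
    then obtain cs f where bs: "bs = cs @ [f]" by (metis rev_exhaust)
    then have "mon (Egen_star e # star_word bs) = \<zero>\<^bsub>L\<^esub>"
      using False assms mon_context_zero[OF mon_S_star_S_star, of f e "[]" "star_word cs"]
      by (simp add: epath_def)
    then show ?thesis using * by simp
  qed
next
  case (Cons f fs)
  show ?thesis
  proof (cases "e = f")
    case False
    then show ?thesis
      using Cons assms mon_context_zero[OF mon_S_star_S_neq, of e f "[]" "normal_word fs A bs"]
      by (simp add: normal_word_def epath_def)
  next
    case True
    have "mon (Egen_star e # normal_word as A bs) = mon (Vgen (rng G e) # normal_word fs A bs)"
      using Cons True assms mon_context[OF mon_S_star_S, of e "[]" "normal_word fs A bs"]
      by (simp add: normal_word_def epath_def)
    \<comment> \<open>The pair deleted from the word cancels in the degree as well, since degrees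
      are reduced words.\<close>
    moreover have "word_degree (Egen_star e # normal_word as A bs) = word_degree (Vgen (rng G e) # normal_word fs A bs)"
      using Cons True by (simp add: normal_word_def push_letter_cancel reduced_word_degree)
    ultimately show ?thesis
      using normal_Vgen_Cons[of fs bs A "rng G e"] Cons assms
      by (simp add: gen_verts.range epath_Cons)
  qed
qed

text \<open>The letters are prepended one at a time to a normal word. Zero is a separate alternative
  because a rewriting step may kill the word; otherwise each step keeps the degree.\<close>

lemma normal_or_zero: "w \<noteq> [] \<Longrightarrow> set w \<subseteq> generators G \<Longrightarrow>
    mon w \<in> insert \<zero>\<^bsub>L\<^esub> (normal_forms (word_degree w))"
proof (induction w rule: list_nonempty_induct)
  case (single x)
  then show ?case
  proof (cases x)
    case (Vgen A)
    then show ?thesis using single normalI[of "[x]" "[]" A "[]"] by (simp add: normal_word_def)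
  next
    case (Egen e)
    then show ?thesis
      using single normalI[of "[x]" "[e]" "rng G e" "[]"]
      by (simp add: gen_verts.range normal_word_def epath_def mon_S_rng)
  next
    case (Egen_star e)
    then show ?thesis
      using single normalI[of "[x]" "[]" "rng G e" "[e]"]
      by (simp add: gen_verts.range normal_word_def epath_def mon_rng_S_star)
  qed
next
  case (cons x w)
  then consider "mon w = \<zero>\<^bsub>L\<^esub>" | "mon w \<in> normal_forms (word_degree w)" by auto
  then show ?case
  proof cases
    case 1
    then show ?thesis using mon_context_zero[of w "[x]" "[]"] cons.prems by simp
  next
    case 2
    then obtain as A bs where w: "epath as" "epath bs" "A \<in> gen_verts G"
      "mon w = mon (normal_word as A bs)" "word_degree w = word_degree (normal_word as A bs)"
      unfolding normal_forms_def by (auto simp: word_degree_normal_word)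
    have mon: "mon (x # w) = mon (x # normal_word as A bs)"
      using mon_context[OF w(4), of "[x]" "[]"] cons.prems by simp
    have deg: "word_degree (x # w) = word_degree (x # normal_word as A bs)"
      using w(5) by (cases x) simp_all
    have "mon (x # normal_word as A bs) \<in> insert \<zero>\<^bsub>L\<^esub> (normal_forms (word_degree (x # normal_word as A bs)))"
      using cons.prems w normal_Vgen_Cons normal_Egen_Cons normal_Egen_star_Cons
      by (cases x) simp_all
    then show ?thesis unfolding mon deg .
  qed
qed

section \<open>The homogeneous components\<close>

lemma lpa_gen_eq: "lpa_gen G x = mon [x]"
  by (simp add: lpa_gen_def mon_def gen_def)

lemma mult_list_mon:
  "w \<noteq> [] \<Longrightarrow> set w \<subseteq> generators G \<Longrightarrow> mult_list L (map (\<lambda>x. mon [x]) w) = mon w"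
proof (induction w rule: list_nonempty_induct)
  case (cons x w)
  then show ?case by (cases w) (simp_all add: mon_mult)
qed simp

fun path_word :: "('v, 'e) fpath \<Rightarrow> ('v, 'e) generator list" where
  "path_word (VPath A) = [Vgen A]"
| "path_word (EPath es) = edge_word es"

fun path_word_star :: "('v, 'e) fpath \<Rightarrow> ('v, 'e) generator list" where
  "path_word_star (VPath A) = [Vgen A]"
| "path_word_star (EPath es) = star_word es"

lemma finite_paths_cases:
  assumes "\<alpha> \<in> finite_paths G"
  obtains A where "\<alpha> = VPath A" "A \<in> gen_verts G"
  | es where "\<alpha> = EPath es" "es \<noteq> []" "epath es"
  using assms unfolding finite_paths_def epath_def by blast

lemma path_word_generators:
  assumes "\<alpha> \<in> finite_paths G"
  shows "path_word \<alpha> \<noteq> []" "set (path_word \<alpha>) \<subseteq> generators G"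
    "path_word_star \<alpha> \<noteq> []" "set (path_word_star \<alpha>) \<subseteq> generators G"
  using assms by (cases rule: finite_paths_cases; simp add: epath_def)+

lemma path_elem_eq:
  assumes "\<alpha> \<in> finite_paths G"
  shows "path_elem R G \<alpha> = mon (path_word \<alpha>)" "path_elem_star R G \<alpha> = mon (path_word_star \<alpha>)"
proof -
  have "path_elem R G \<alpha> = mon (path_word \<alpha>) \<and> path_elem_star R G \<alpha> = mon (path_word_star \<alpha>)"
    using assms
  proof (cases rule: finite_paths_cases)
    case (1 A)
    then show ?thesis by (simp add: lpa_gen_eq)
  next
    case (2 es)
    then show ?thesis
      using mult_list_mon[of "edge_word es"] mult_list_mon[of "star_word es"]
      by (simp add: lpa_gen_eq epath_def) (simp add: edge_word_def star_word_def comp_def)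
  qed
  then show "path_elem R G \<alpha> = mon (path_word \<alpha>)" "path_elem_star R G \<alpha> = mon (path_word_star \<alpha>)"
    by auto
qed

lemma path_degree_in_free_group:
  "\<alpha> \<in> finite_paths G \<Longrightarrow> path_degree \<alpha> \<in> carrier (free_group (edges G))"
  using reduced_pos unfolding pos_def by (fastforce elim!: finite_paths_cases simp: epath_def)

lemma inv_path_degree:
  assumes "\<alpha> \<in> finite_paths G"
  shows "inv\<^bsub>free_group (edges G)\<^esub> path_degree \<alpha> = word_degree (path_word_star \<alpha>)"
  unfolding inv_free_group[OF path_degree_in_free_group[OF assms]]
  using assms
  by (cases rule: finite_paths_cases) (simp_all add: word_degree_star_word flip: rev_inv_pos pos_def)

lemma path_degree_eq:
  assumes "\<alpha> \<in> finite_paths G"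
  shows "path_degree \<alpha> = word_degree (path_word \<alpha>)"
  using assms word_degree_edge_word_append[of _ "[]"]
  by (cases rule: finite_paths_cases) (simp_all add: foldr_push_reduced reduced_pos flip: pos_def)

text \<open>This is the set whose linear span \<open>lpa_component\<close> takes, written so that it
  can be folded in that definition.\<close>

definition spanning :: "('e \<times> bool) list \<Rightarrow> (('v, 'e) generator list \<Rightarrow>\<^sub>0 'r) set set" where
  "spanning t = {path_elem R G \<alpha> \<otimes>\<^bsub>L\<^esub> lpa_gen G (Vgen A) \<otimes>\<^bsub>L\<^esub> path_elem_star R G \<beta> | \<alpha> A \<beta>.
     \<alpha> \<in> finite_paths G \<and> A \<in> gen_verts G \<and> \<beta> \<in> finite_paths G \<and>
     path_degree \<alpha> \<otimes>\<^bsub>free_group (edges G)\<^esub> inv\<^bsub>free_group (edges G)\<^esub> path_degree \<beta> = t}"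

lemma spanning_eq:
  "spanning t = {mon (path_word \<alpha> @ [Vgen A] @ path_word_star \<beta>) | \<alpha> A \<beta>.
     \<alpha> \<in> finite_paths G \<and> A \<in> gen_verts G \<and> \<beta> \<in> finite_paths G \<and>
     word_degree (path_word \<alpha> @ [Vgen A] @ path_word_star \<beta>) = t}"
proof -
  have "path_elem R G \<alpha> \<otimes>\<^bsub>L\<^esub> lpa_gen G (Vgen A) \<otimes>\<^bsub>L\<^esub> path_elem_star R G \<beta> =
      mon (path_word \<alpha> @ [Vgen A] @ path_word_star \<beta>)"
    "path_degree \<alpha> \<otimes>\<^bsub>free_group (edges G)\<^esub> inv\<^bsub>free_group (edges G)\<^esub> path_degree \<beta> =
      word_degree (path_word \<alpha> @ [Vgen A] @ path_word_star \<beta>)"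
    if "\<alpha> \<in> finite_paths G" "A \<in> gen_verts G" "\<beta> \<in> finite_paths G" for \<alpha> A \<beta>
    using that
    by (simp_all add: path_elem_eq lpa_gen_eq mon_mult path_word_generators inv_path_degree
        word_degree_append) (simp add: path_degree_eq)
  note * = this
  show ?thesis unfolding spanning_def
    by (rule Collect_cong, intro iff_exI) (use * in metis)
qed

lemma normal_forms_subset_spanning: "normal_forms t \<subseteq> spanning t"
proof
  fix x assume "x \<in> normal_forms t"
  then obtain as A bs where x: "epath as" "epath bs" "A \<in> gen_verts G"
    "x = mon (normal_word as A bs)" "word_degree (normal_word as A bs) = t"
    unfolding normal_forms_def by (auto simp: word_degree_normal_word)
  \<comment> \<open>A path of length zero has to name a vertex set. Taking \<open>A\<close> itself
    is harmless, because \<open>p_A\<close> is idempotent.\<close>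
  define \<alpha> \<beta> where "\<alpha> = (if as = [] then VPath A else EPath as)"
    and "\<beta> = (if bs = [] then VPath A else EPath bs)"
  have "\<alpha> \<in> finite_paths G" "\<beta> \<in> finite_paths G"
    using x by (auto simp: \<alpha>_def \<beta>_def finite_paths_def epath_def)
  moreover have "mon (path_word \<alpha> @ [Vgen A] @ path_word_star \<beta>) = mon (normal_word as A bs)"
    using x mon_context[OF mon_PP[of A A], of "[]" "path_word_star \<beta>"]
      mon_context[OF mon_PP[of A A], of "edge_word as" "[]"] mon_PP[of A A]
    by (auto simp: \<alpha>_def \<beta>_def normal_word_def epath_def)
  moreover have "word_degree (path_word \<alpha> @ [Vgen A] @ path_word_star \<beta>) = t"
    unfolding x(5)[symmetric] by (simp add: \<alpha>_def \<beta>_def normal_word_def word_degree_append)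
  ultimately show "x \<in> spanning t"
    unfolding spanning_eq using x by blast
qed

lemma mon_in_homs: "w \<noteq> [] \<Longrightarrow> set w \<subseteq> generators G \<Longrightarrow> word_degree w = t \<Longrightarrow> mon w \<in> cls ` homs t"
  by (auto simp: mon_def homs_def single_in_free_algebra homogeneous_single)

lemma spanning_subset: "spanning t \<subseteq> cls ` homs t"
  unfolding spanning_eq by (clarify, rule mon_in_homs) (simp_all add: path_word_generators)

lemma spanning_carrier: "spanning t \<subseteq> carrier L"
  using spanning_subset by (auto simp: homs_def L_carrier)

lemma smult_closed: "x \<in> carrier L \<Longrightarrow> r \<odot>\<^bsub>L\<^esub> x \<in> carrier L"
  by (auto simp: L_carrier L_smult intro: scale_in_free_algebra)

lemma linear_span_carrier: "x \<in> linear_span L (spanning t) \<Longrightarrow> x \<in> carrier L"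
proof (induction rule: linear_span.induct)
  case (add x y r)
  then show ?case by (simp add: smult_closed subsetD[OF spanning_carrier])
qed simp

lemma linear_span_add:
  assumes "x \<in> linear_span L (spanning t)" "y \<in> linear_span L (spanning t)"
  shows "x \<oplus>\<^bsub>L\<^esub> y \<in> linear_span L (spanning t)"
  using assms(1)
proof induction
  case zero
  then show ?case using assms(2) linear_span_carrier by simp
next
  case (add x z r)
  then have "r \<odot>\<^bsub>L\<^esub> x \<in> carrier L" by (intro smult_closed subsetD[OF spanning_carrier])
  then show ?case
    using add linear_span_carrier[OF assms(2)] linear_span_carrier[OF add(2)]
    by (simp add: a_assoc linear_span.add)
qed

lemma smult_zero_L: "r \<odot>\<^bsub>L\<^esub> \<zero>\<^bsub>L\<^esub> = \<zero>\<^bsub>L\<^esub>"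
  by (simp add: L_zero L_smult scale_def)

text \<open>Spanning elements are monomials of degree \<open>t\<close>, which gives one inclusion.
  Conversely, each word in the support of a homogeneous representative has degree \<open>t\<close>,
  and \<open>normal_or_zero\<close> makes it zero or a spanning element.\<close>

lemma lpa_component_eq: "lpa_component R G t = cls ` homs t"
proof
  have "x \<in> cls ` homs t" if "x \<in> linear_span L (spanning t)" for x
    using that
  proof induction
    case zero
    show ?case unfolding L_zero by (rule imageI) (simp add: homs_def)
  next
    case (add x y r)
    then obtain a b where "x = cls a" "y = cls b" "a \<in> homs t" "b \<in> homs t"
      using spanning_subset by blast
    then show ?case
      by (auto simp: L_smult L_add homs_def
          intro!: imageI homogeneous_add homogeneous_scale add_in_free_algebra scale_in_free_algebra)
  qed
  then show "lpa_component R G t \<subseteq> cls ` homs t"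
    unfolding lpa_component_def Let_def spanning_def[symmetric] by blast
  have "cls a \<in> linear_span L (spanning t)" if "a \<in> homs t" for a
  proof -
    have a: "a \<in> FA" "homogeneous t a" using that by (auto simp: homs_def)
    from a(1) show ?thesis
    proof (induction a rule: free_algebra_induct)
      case zero
      show ?case unfolding L_zero[symmetric] by (rule linear_span.zero)
    next
      case (single w r)
      then have "word_degree w = t" using a(2) by (simp add: homogeneous_def)
      then consider "mon w = \<zero>\<^bsub>L\<^esub>" | "mon w \<in> spanning t"
        using normal_or_zero[of w] single normal_forms_subset_spanning[of t] by auto
      then show ?case
      proof cases
        case 1
        then show ?thesis
          unfolding smult_mon[symmetric] by (simp add: smult_zero_L linear_span.zero)
      next
        case 2
        have "r \<odot>\<^bsub>L\<^esub> mon w \<in> carrier L"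
          using single unfolding smult_mon by (intro L_carrier_cls single_in_free_algebra)
        then show ?thesis
          using linear_span.add[OF 2 linear_span.zero, where M = L and r = r] by (simp add: smult_mon)
      qed
    qed (auto simp: L_add[symmetric] intro: linear_span_add)
  qed
  then show "cls ` homs t \<subseteq> lpa_component R G t"
    unfolding lpa_component_def Let_def spanning_def[symmetric] by blast
qed

lemma group_grading_lpa: "group_grading (free_group (edges G)) L (lpa_component R G)"
  using group_grading_homs unfolding lpa_component_eq[symmetric] .

section \<open>Units\<close>

lemma mon_PP_context:
  assumes "A \<in> gen_verts G" "B \<in> gen_verts G" "set x \<subseteq> generators G" "set y \<subseteq> generators G"
  shows "mon (x @ Vgen A # Vgen B # y) = mon (x @ Vgen (A \<inter> B) # y)"
  using mon_context[OF mon_PP[OF assms(1,2)] assms(3,4)] by simp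

lemma word_local_unit:
  assumes "w \<noteq> []" "set w \<subseteq> generators G"
  shows "\<exists>A\<in>gen_verts G. mon (Vgen A # w) = mon w" "\<exists>A\<in>gen_verts G. mon (w @ [Vgen A]) = mon w"
proof -
  obtain x v where w: "w = x # v" using assms(1) by (cases w) auto
  have "\<exists>A\<in>gen_verts G. mon [Vgen A, x] = mon [x]"
  proof (cases x)
    case (Vgen A)
    then show ?thesis using assms(2) w by (intro bexI[of _ A]) (simp_all add: mon_PP)
  next
    case (Egen e)
    then show ?thesis
      using assms(2) w by (intro bexI[of _ "{src G e}"]) (simp_all add: mon_src_S src_in_gen_verts)
  next
    case (Egen_star e)
    then show ?thesis
      using assms(2) w by (intro bexI[of _ "rng G e"]) (simp_all add: mon_rng_S_star gen_verts.range)
  qed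
  then show "\<exists>A\<in>gen_verts G. mon (Vgen A # w) = mon w"
    using mon_context[of "[Vgen _, x]" "[x]" "[]" v] assms(2) w by force
  obtain y u where w: "w = u @ [y]" using assms(1) by (metis rev_exhaust)
  have "\<exists>A\<in>gen_verts G. mon [y, Vgen A] = mon [y]"
  proof (cases y)
    case (Vgen A)
    then show ?thesis using assms(2) w by (intro bexI[of _ A]) (simp_all add: mon_PP)
  next
    case (Egen e)
    then show ?thesis
      using assms(2) w by (intro bexI[of _ "rng G e"]) (simp_all add: mon_S_rng gen_verts.range)
  next
    case (Egen_star e)
    then show ?thesis
      using assms(2) w by (intro bexI[of _ "{src G e}"]) (simp_all add: mon_S_star_src src_in_gen_verts)
  qed
  then show "\<exists>A\<in>gen_verts G. mon (w @ [Vgen A]) = mon w"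
    using mon_context[of "[y, Vgen _]" "[y]" u "[]"] assms(2) w by force
qed

text \<open>For \<open>A\<close> inside \<open>B\<close> the product of the projections is
  \<open>p_A\<close>, so a larger set can only do better. This lets finitely many words share one
  local unit.\<close>

lemma word_local_unit_mono:
  assumes "set w \<subseteq> generators G" "A \<in> gen_verts G" "B \<in> gen_verts G" "A \<subseteq> B"
  shows "mon (Vgen A # w) = mon w \<Longrightarrow> mon (Vgen B # w) = mon w"
    and "mon (w @ [Vgen A]) = mon w \<Longrightarrow> mon (w @ [Vgen B]) = mon w"
proof -
  have AB: "A \<inter> B = A" "B \<inter> A = A" using assms by auto
  show "mon (Vgen B # w) = mon w" if "mon (Vgen A # w) = mon w"
    using mon_context[OF that, of "[Vgen B]" "[]"] mon_PP_context[of B A "[]" w] that assms AB by simp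
  show "mon (w @ [Vgen B]) = mon w" if "mon (w @ [Vgen A]) = mon w"
    using mon_context[OF that, of "[]" "[Vgen B]"] mon_PP_context[of A B w "[]"] that assms AB by simp
qed

lemma single_eq_smult: "cls (Poly_Mapping.single w r) = r \<odot>\<^bsub>L\<^esub> mon w"
  by (simp add: smult_mon)

lemma smult_mult:
  assumes "x \<in> carrier L" "y \<in> carrier L"
  shows "x \<otimes>\<^bsub>L\<^esub> (r \<odot>\<^bsub>L\<^esub> y) = r \<odot>\<^bsub>L\<^esub> (x \<otimes>\<^bsub>L\<^esub> y)" "(r \<odot>\<^bsub>L\<^esub> x) \<otimes>\<^bsub>L\<^esub> y = r \<odot>\<^bsub>L\<^esub> (x \<otimes>\<^bsub>L\<^esub> y)"
proof -
  obtain a b where ab: "a \<in> FA" "b \<in> FA" "x = cls a" "y = cls b" using assms by (auto simp: L_carrier)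
  have "a * scale r b = (a * Poly_Mapping.single [] r) * b" by (simp add: scale_def mult.assoc)
  also have "\<dots> = scale r (a * b)" unfolding mult_single_Nil by (simp add: scale_def mult.assoc)
  finally show "x \<otimes>\<^bsub>L\<^esub> (r \<odot>\<^bsub>L\<^esub> y) = r \<odot>\<^bsub>L\<^esub> (x \<otimes>\<^bsub>L\<^esub> y)"
    "(r \<odot>\<^bsub>L\<^esub> x) \<otimes>\<^bsub>L\<^esub> y = r \<odot>\<^bsub>L\<^esub> (x \<otimes>\<^bsub>L\<^esub> y)"
    using ab by (simp_all add: L_smult L_mult scale_in_free_algebra scale_mult_left)
qed

lemma fixed_by_left_right:
  assumes "u \<in> carrier L" "v \<in> carrier L" "a \<in> FA"
    and "\<And>w. w \<in> Poly_Mapping.keys a \<Longrightarrow> w \<noteq> [] \<Longrightarrow> set w \<subseteq> generators G \<Longrightarrow>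
      u \<otimes>\<^bsub>L\<^esub> mon w = mon w \<and> mon w \<otimes>\<^bsub>L\<^esub> v = mon w"
  shows "u \<otimes>\<^bsub>L\<^esub> cls a = cls a \<and> cls a \<otimes>\<^bsub>L\<^esub> v = cls a"
  using assms(3)
proof (induction a rule: free_algebra_induct)
  case zero
  obtain b c where "u = cls b" "v = cls c" "b \<in> FA" "c \<in> FA" using assms(1,2) by (auto simp: L_carrier)
  then show ?case by (simp add: L_mult)
next
  case (single w r)
  then show ?case
    using assms(4)[of w] assms(1,2) by (simp add: single_eq_smult smult_mult mon_closed)
next
  case (add b c)
  then show ?case
    using assms(1,2) by (simp add: L_add[symmetric] l_distr r_distr L_carrier_cls)
qed

lemma local_unit:
  assumes "x \<in> carrier L"
  obtains A where "A \<in> gen_verts G" "mon [Vgen A] \<otimes>\<^bsub>L\<^esub> x = x" "x \<otimes>\<^bsub>L\<^esub> mon [Vgen A] = x"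
proof -
  obtain a where a: "a \<in> FA" "x = cls a" using assms by (auto simp: L_carrier)
  have w: "w \<noteq> []" "set w \<subseteq> generators G" if "w \<in> Poly_Mapping.keys a" for w
    using a that by (auto simp: free_algebra_def)
  have "\<forall>w\<in>Poly_Mapping.keys a. \<exists>A. A \<in> gen_verts G \<and> mon (Vgen A # w) = mon w"
    "\<forall>w\<in>Poly_Mapping.keys a. \<exists>A. A \<in> gen_verts G \<and> mon (w @ [Vgen A]) = mon w"
    unfolding Bex_def[symmetric] by (intro ballI word_local_unit w; assumption)+
  from this[THEN bchoice] obtain f g where
    f: "\<And>w. w \<in> Poly_Mapping.keys a \<Longrightarrow> f w \<in> gen_verts G \<and> mon (Vgen (f w) # w) = mon w" and
    g: "\<And>w. w \<in> Poly_Mapping.keys a \<Longrightarrow> g w \<in> gen_verts G \<and> mon (w @ [Vgen (g w)]) = mon w"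
    by blast
  \<comment> \<open>One finite union serves both sides of all words in the support; for the zero
    representative it is the empty set, which also belongs to \<open>gen_verts G\<close>.\<close>
  define A where "A = \<Union> (f ` Poly_Mapping.keys a \<union> g ` Poly_Mapping.keys a)"
  have A: "A \<in> gen_verts G" unfolding A_def using f g by (intro gen_verts.union) auto
  have "mon [Vgen A] \<otimes>\<^bsub>L\<^esub> cls a = cls a \<and> cls a \<otimes>\<^bsub>L\<^esub> mon [Vgen A] = cls a"
  proof (rule fixed_by_left_right)
    fix v assume v: "v \<in> Poly_Mapping.keys a"
    have "f v \<subseteq> A" "g v \<subseteq> A" unfolding A_def using v by auto
    then have "mon (Vgen A # v) = mon v" "mon (v @ [Vgen A]) = mon v"
      using word_local_unit_mono(1)[OF w(2)[OF v] _ A, of "f v"]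
        word_local_unit_mono(2)[OF w(2)[OF v] _ A, of "g v"] f[OF v] g[OF v] by simp_all
    then show "mon [Vgen A] \<otimes>\<^bsub>L\<^esub> mon v = mon v \<and> mon v \<otimes>\<^bsub>L\<^esub> mon [Vgen A] = mon v"
      using w[OF v] A by (simp add: mon_mult)
  qed (use a A in \<open>auto intro: mon_closed\<close>)
  then show ?thesis using that A a by blast
qed

lemma unital_imp_vertex_unit:
  assumes "unital L"
  obtains X where "X \<in> gen_verts G"
    "\<And>w. w \<noteq> [] \<Longrightarrow> set w \<subseteq> generators G \<Longrightarrow> mon (Vgen X # w) = mon w"
    "\<And>w. w \<noteq> [] \<Longrightarrow> set w \<subseteq> generators G \<Longrightarrow> mon (w @ [Vgen X]) = mon w"
proof -
  from assms obtain u where u: "u \<in> carrier L"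
    "\<forall>x\<in>carrier L. u \<otimes>\<^bsub>L\<^esub> x = x \<and> x \<otimes>\<^bsub>L\<^esub> u = x"
    unfolding unital_def by (rule bexE)
  obtain X where X: "X \<in> gen_verts G" "mon [Vgen X] \<otimes>\<^bsub>L\<^esub> u = u" "u \<otimes>\<^bsub>L\<^esub> mon [Vgen X] = u"
    using local_unit[OF u(1)] .
  \<comment> \<open>The product of \<open>u\<close> and \<open>p_X\<close> is \<open>u\<close> by
    the choice of \<open>X\<close>, and it is \<open>p_X\<close> because \<open>u\<close> is the
    unit.\<close>
  then have u_eq: "u = mon [Vgen X]" using bspec[OF u(2), of "mon [Vgen X]"] by (simp add: mon_closed)
  show ?thesis
  proof (rule that[OF X(1)])
    fix w assume w: "w \<noteq> []" "set w \<subseteq> generators G"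
    then show "mon (Vgen X # w) = mon w" "mon (w @ [Vgen X]) = mon w"
      using bspec[OF u(2) mon_closed[OF w]] X(1) mon_mult[of "[Vgen X]" w] mon_mult[of w "[Vgen X]"]
      by (simp_all add: u_eq)
  qed
qed

text \<open>If \<open>u\<close> is the unit in neutral degree and \<open>p_A\<close> is a local unit
  of \<open>x\<close>, then \<open>u x = u p_A x = p_A x = x\<close>, and symmetrically on the
  right.\<close>

lemma epsilon_strongly_graded_imp_unital:
  assumes "epsilon_strongly_graded (free_group (edges G)) L (lpa_component R G)"
  shows "unital L"
proof -
  have one: "[] \<in> carrier (free_group (edges G))" "inv\<^bsub>free_group (edges G)\<^esub> [] = []"
    by (simp, simp add: inv_free_group)
  \<comment> \<open>The neutral element is its own inverse, so the same local unit acts on the left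
    and on the right.\<close>
  from assms one obtain u where u: "u \<in> ideal_prod L (lpa_component R G []) (lpa_component R G [])"
    "\<And>s. s \<in> lpa_component R G [] \<Longrightarrow> u \<otimes>\<^bsub>L\<^esub> s = s \<and> s \<otimes>\<^bsub>L\<^esub> u = s"
    unfolding group_grading.epsilon_strongly_graded_iff[OF group_grading_lpa]
    by (auto simp: one simp del: free_group_simps dest!: bspec[OF _ one(1)])
  have u_carrier: "u \<in> carrier L" using group_grading.ideal_prod_carrier[OF group_grading_lpa one(1) one(1) u(1)] .
  have "u \<otimes>\<^bsub>L\<^esub> x = x \<and> x \<otimes>\<^bsub>L\<^esub> u = x" if x: "x \<in> carrier L" for x
  proof -
    obtain A where A: "A \<in> gen_verts G" "mon [Vgen A] \<otimes>\<^bsub>L\<^esub> x = x" "x \<otimes>\<^bsub>L\<^esub> mon [Vgen A] = x"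
      using local_unit[OF x] .
    have p: "mon [Vgen A] \<in> carrier L" "mon [Vgen A] \<in> lpa_component R G []"
      using A(1) unfolding lpa_component_eq by (auto intro: mon_closed mon_in_homs)
    show ?thesis
      using m_assoc[OF u_carrier p(1) x] m_assoc[OF x p(1) u_carrier] u(2)[OF p(2)] A by simp
  qed
  then show ?thesis unfolding unital_def using u_carrier by blast
qed

end

section \<open>The local units of the components\<close>

text \<open>The assumptions say that \<open>p_X\<close> is the unit of the algebra, in a form suited
  to rewriting words.\<close>

locale unital_ultragraph_algebra = ultragraph_algebra G R
  for G :: "('v, 'e) pre_ultragraph" and R :: "'r::{comm_ring, comm_monoid_mult} itself" +
  fixes X
  assumes X_in_gen_verts: "X \<in> gen_verts G"
    and X_left: "w \<noteq> [] \<Longrightarrow> set w \<subseteq> generators G \<Longrightarrow> mon (Vgen X # w) = mon w"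
    and X_right: "w \<noteq> [] \<Longrightarrow> set w \<subseteq> generators G \<Longrightarrow> mon (w @ [Vgen X]) = mon w"
begin

section \<open>Ranges of paths and their absorption\<close>

definition path_rng :: "'e list \<Rightarrow> 'v set" where
  "path_rng as = (if as = [] then X else rng G (last as))"

lemma path_rng_in_gen_verts: "epath as \<Longrightarrow> path_rng as \<in> gen_verts G"
  by (auto simp: path_rng_def X_in_gen_verts epath_def intro!: gen_verts.range dest: last_in_set)

text \<open>The letter for \<open>p_X\<close> may be erased as long as another letter remains, since
  the empty word does not represent the unit here.\<close>

lemma X_context:
  assumes "x \<noteq> [] \<or> y \<noteq> []" "set x \<subseteq> generators G" "set y \<subseteq> generators G"
  shows "mon (x @ Vgen X # y) = mon (x @ y)"
proof (cases "y = []")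
  case True
  then show ?thesis using X_right assms by simp
next
  case False
  then show ?thesis using mon_context[OF X_left, of y x "[]"] assms by simp
qed

lemma mon_edge_word_rng:
  assumes "epath as" "x \<noteq> [] \<or> as \<noteq> [] \<or> y \<noteq> []" "set x \<subseteq> generators G" "set y \<subseteq> generators G"
  shows "mon (x @ edge_word as @ Vgen (path_rng as) # y) = mon (x @ edge_word as @ y)"
proof (cases as rule: rev_cases)
  case Nil
  then show ?thesis using X_context assms by (simp add: path_rng_def)
next
  case (snoc bs e)
  then show ?thesis
    using assms mon_context[OF mon_S_rng, of e "x @ edge_word bs" y] by (simp add: path_rng_def epath_def)
qed

lemma mon_rng_star_word:
  assumes "epath as" "x \<noteq> [] \<or> as \<noteq> [] \<or> y \<noteq> []" "set x \<subseteq> generators G" "set y \<subseteq> generators G"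
  shows "mon (x @ Vgen (path_rng as) # star_word as @ y) = mon (x @ star_word as @ y)"
proof (cases as rule: rev_cases)
  case Nil
  then show ?thesis using X_context assms by (simp add: path_rng_def)
next
  case (snoc bs e)
  then show ?thesis
    using assms mon_context[OF mon_rng_S_star, of e x "star_word bs @ y"] by (simp add: path_rng_def epath_def)
qed

text \<open>This is \<open>s_\<alpha>^* s_\<alpha> = p_{r(\<alpha>)}\<close> inside a word. The
  innermost pair \<open>s_e^* s_e\<close> becomes \<open>p_{r(e)}\<close>, which the next edge
  absorbs because its source lies in \<open>r(e)\<close>; for the empty path the result is the unit
  \<open>p_X\<close>.\<close>

lemma mon_star_edge_word:
  assumes "epath as" "x \<noteq> [] \<or> as \<noteq> [] \<or> y \<noteq> []" "set x \<subseteq> generators G" "set y \<subseteq> generators G"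
  shows "mon (x @ star_word as @ edge_word as @ y) = mon (x @ Vgen (path_rng as) # y)"
  using assms
proof (induction as arbitrary: x y)
  case Nil
  then show ?case using X_context by (simp add: path_rng_def)
next
  case (Cons e es)
  then have e: "e \<in> edges G" "epath es" "es \<noteq> [] \<Longrightarrow> src G (hd es) \<in> rng G e"
    by (auto simp: epath_Cons)
  note es = e(2)[unfolded epath_def, THEN conjunct1]
  have *: "mon (x @ star_word (e # es) @ edge_word (e # es) @ y) = mon ((x @ star_word es) @ Vgen (rng G e) # edge_word es @ y)"
    using mon_context[OF mon_S_star_S, of e "x @ star_word es" "edge_word es @ y"] Cons.prems e es by simp
  show ?case
  proof (cases es)
    case Nil
    then show ?thesis using * by (simp add: path_rng_def)
  next
    case (Cons f fs)
    then have "mon [Vgen (rng G e), Egen f] = mon [Egen f]"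
      using e by (simp add: mon_P_S gen_verts.range epath_Cons)
    then have "mon ((x @ star_word es) @ Vgen (rng G e) # edge_word es @ y) = mon (x @ star_word es @ edge_word es @ y)"
      using mon_context[of "[Vgen (rng G e), Egen f]" "[Egen f]" "x @ star_word es" "edge_word fs @ y"] Cons.prems e es Cons
      by simp
    also have "\<dots> = mon (x @ Vgen (path_rng es) # y)"
      using Cons.IH[of x y] e Cons Cons.prems(3,4) by simp
    finally show ?thesis using * Cons by (simp add: path_rng_def)
  qed
qed

text \<open>Along a path the source of \<open>f\<close> lies in the range of the edge before it; if
  there is none, the projection is the unit.\<close>

lemma mon_rng_Egen:
  assumes "epath (as @ f # fs)"
  shows "mon [Vgen (path_rng as), Egen f] = mon [Egen f]"
    and "mon [Egen_star f, Vgen (path_rng as)] = mon [Egen_star f]"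
proof -
  have f: "f \<in> edges G" using assms by (simp add: epath_append epath_Cons)
  have "mon [Vgen (path_rng as), Egen f] = mon [Egen f] \<and>
      mon [Egen_star f, Vgen (path_rng as)] = mon [Egen_star f]"
  proof (cases "as = []")
    case True
    then show ?thesis
      using X_left[of "[Egen f]"] X_right[of "[Egen_star f]"] f by (simp add: path_rng_def)
  next
    case False
    then show ?thesis
      using assms f path_rng_in_gen_verts[of as]
      by (simp add: mon_P_S mon_S_star_P epath_append path_rng_def)
  qed
  then show "mon [Vgen (path_rng as), Egen f] = mon [Egen f]"
    "mon [Egen_star f, Vgen (path_rng as)] = mon [Egen_star f]" by auto
qed

text \<open>Inserting the ranges of both paths around \<open>p_A\<close> in
  \<open>s_\<alpha> p_A s_\<beta>^*\<close> shows that only the part of \<open>A\<close> inside this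
  intersection matters.\<close>

definition corner :: "'e list \<Rightarrow> 'e list \<Rightarrow> 'v set" where
  "corner as bs = path_rng as \<inter> path_rng bs"

lemma corner_in_gen_verts: "epath as \<Longrightarrow> epath bs \<Longrightarrow> corner as bs \<in> gen_verts G"
  by (simp add: corner_def Int_in_gen_verts path_rng_in_gen_verts)

lemma set_normal_word: "epath as \<Longrightarrow> epath bs \<Longrightarrow> A \<in> gen_verts G \<Longrightarrow> set (normal_word as A bs) \<subseteq> generators G"
  by (simp add: normal_word_def epath_def)

lemma normal_word_not_Nil [simp]: "normal_word as A bs \<noteq> []"
  by (simp add: normal_word_def)

text \<open>Collapsing \<open>s_\<alpha>^* s_\<alpha>\<close> leaves \<open>s_\<alpha>\<close>
  followed by the projection on the intersection of both ranges. Its factor for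
  \<open>r(\<alpha>)\<close> is absorbed to the left by \<open>s_\<alpha>\<close>, its factor for
  \<open>r(\<beta>)\<close> by what stands to the right.\<close>

lemma mon_left_unit:
  assumes "epath (as @ cs)" "epath (bs @ cs)" "A \<in> gen_verts G"
  shows "mon (normal_word as (corner as bs) as @ normal_word (as @ cs) A (bs @ cs)) = mon (normal_word (as @ cs) A (bs @ cs))"
proof -
  let ?a = "path_rng as" and ?b = "path_rng bs" and ?Z = "edge_word cs @ Vgen A # star_word cs @ star_word bs"
  have p: "epath as" "epath bs" "epath cs" using assms by (auto simp: epath_append)
  then have g: "set as \<subseteq> edges G" "set bs \<subseteq> edges G" "set cs \<subseteq> edges G" by (auto simp: epath_def)
  have v: "?a \<in> gen_verts G" "?b \<in> gen_verts G" "corner as bs \<in> gen_verts G"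
    using p by (auto intro: path_rng_in_gen_verts corner_in_gen_verts)
  have "mon (normal_word as (corner as bs) as @ normal_word (as @ cs) A (bs @ cs)) =
      mon ((edge_word as @ [Vgen (corner as bs)]) @ star_word as @ edge_word as @ ?Z)"
    by (simp add: normal_word_def)
  also have "\<dots> = mon (edge_word as @ Vgen (corner as bs) # Vgen ?a # ?Z)"
    by (subst mon_star_edge_word) (use p g v assms in auto)
  also have "\<dots> = mon (edge_word as @ Vgen (corner as bs \<inter> ?a) # ?Z)"
    by (rule mon_PP_context) (use g v assms in auto)
  also have "corner as bs \<inter> ?a = ?a \<inter> ?b" by (auto simp: corner_def)
  also have "mon (edge_word as @ Vgen (?a \<inter> ?b) # ?Z) = mon (edge_word as @ Vgen ?a # Vgen ?b # ?Z)"
    by (rule mon_PP_context[symmetric]) (use g v assms in auto)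
  also have "\<dots> = mon (edge_word as @ Vgen ?b # ?Z)"
    using mon_edge_word_rng[of as "[]" "Vgen ?b # ?Z"] p g v assms by simp
  also have "\<dots> = mon (edge_word as @ ?Z)"
  \<comment> \<open>If the common suffix is empty, the projection on \<open>r(\<beta>)\<close>
    commutes past \<open>p_A\<close> and disappears into \<open>s_\<beta>^*\<close>; otherwise the
    first edge of the suffix starts in \<open>r(\<beta>)\<close> and absorbs it.\<close>
  proof (cases cs)
    case Nil
    have "mon (edge_word as @ Vgen ?b # Vgen A # star_word bs) = mon (edge_word as @ Vgen A # Vgen ?b # star_word bs)"
      using mon_PP_context[of ?b A "edge_word as" "star_word bs"] mon_PP_context[of A ?b "edge_word as" "star_word bs"] g v assms
      by (simp add: Int_commute)
    then show ?thesis
      using mon_rng_star_word[of bs "edge_word as @ [Vgen A]" "[]"] p g assms Nil by simp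
  next
    case (Cons f fs)
    then show ?thesis
      using mon_context[OF mon_rng_Egen(1), of bs f fs "edge_word as" "edge_word fs @ Vgen A # star_word cs @ star_word bs"]
        assms g by simp
  qed
  finally show ?thesis by (simp add: normal_word_def)
qed

lemma mon_right_unit:
  assumes "epath (as @ cs)" "epath (bs @ cs)" "A \<in> gen_verts G"
  shows "mon (normal_word (as @ cs) A (bs @ cs) @ normal_word bs (corner bs as) bs) = mon (normal_word (as @ cs) A (bs @ cs))"
proof -
  let ?a = "path_rng as" and ?b = "path_rng bs" and ?W = "edge_word as @ edge_word cs @ Vgen A # star_word cs"
  have p: "epath as" "epath bs" "epath cs" using assms by (auto simp: epath_append)
  then have g: "set as \<subseteq> edges G" "set bs \<subseteq> edges G" "set cs \<subseteq> edges G" by (auto simp: epath_def)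
  have v: "?a \<in> gen_verts G" "?b \<in> gen_verts G" "corner bs as \<in> gen_verts G"
    using p by (auto intro: path_rng_in_gen_verts corner_in_gen_verts)
  have "mon (normal_word (as @ cs) A (bs @ cs) @ normal_word bs (corner bs as) bs) =
      mon (?W @ star_word bs @ edge_word bs @ Vgen (corner bs as) # star_word bs)"
    by (simp add: normal_word_def)
  also have "\<dots> = mon (?W @ Vgen ?b # Vgen (corner bs as) # star_word bs)"
    by (rule mon_star_edge_word) (use p g v assms in auto)
  also have "\<dots> = mon (?W @ Vgen (?b \<inter> corner bs as) # star_word bs)"
    by (rule mon_PP_context) (use g v assms in auto)
  also have "?b \<inter> corner bs as = ?a \<inter> ?b" by (auto simp: corner_def)
  also have "mon (?W @ Vgen (?a \<inter> ?b) # star_word bs) = mon (?W @ Vgen ?a # Vgen ?b # star_word bs)"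
    by (rule mon_PP_context[symmetric]) (use g v assms in auto)
  also have "\<dots> = mon (?W @ Vgen ?a # star_word bs)"
    using mon_rng_star_word[of bs "?W @ [Vgen ?a]" "[]"] p g v assms by simp
  also have "\<dots> = mon (?W @ star_word bs)"
  \<comment> \<open>Now \<open>p_{r(\<alpha>)}\<close> has to vanish to the left: past
    \<open>p_A\<close> into \<open>s_\<alpha>\<close> if the suffix is empty, otherwise into the
    star of the first edge of the suffix.\<close>
  proof (cases cs)
    case Nil
    have "mon (edge_word as @ Vgen A # Vgen ?a # star_word bs) = mon (edge_word as @ Vgen ?a # Vgen A # star_word bs)"
      using mon_PP_context[of ?a A "edge_word as" "star_word bs"] mon_PP_context[of A ?a "edge_word as" "star_word bs"] g v assms
      by (simp add: Int_commute)
    then show ?thesis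
      using mon_edge_word_rng[of as "[]" "Vgen A # star_word bs"] p g assms Nil by simp
  next
    case (Cons f fs)
    then show ?thesis
      using mon_context[OF mon_rng_Egen(2), of as f fs "edge_word as @ edge_word cs @ Vgen A # star_word fs" "star_word bs"]
        assms g by simp
  qed
  finally show ?thesis by (simp add: normal_word_def)
qed

text \<open>This exhibits the local unit as a product of an element of degree
  \<alpha>\<beta>\<inverse> and one of the inverse degree. The middle collapses because the corner
  lies inside \<open>r(\<beta>)\<close>.\<close>

lemma mon_corner_mult:
  assumes "epath as" "epath bs"
  shows "mon (normal_word as (corner as bs) bs @ normal_word bs (corner as bs) as) = mon (normal_word as (corner as bs) as)"
proof -
  let ?c = "corner as bs" and ?b = "path_rng bs"
  have g: "set as \<subseteq> edges G" "set bs \<subseteq> edges G" using assms by (auto simp: epath_def)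
  have v: "?b \<in> gen_verts G" "?c \<in> gen_verts G"
    using assms by (auto intro: path_rng_in_gen_verts corner_in_gen_verts)
  have c: "?c \<inter> ?b = ?c" by (auto simp: corner_def)
  have "mon (normal_word as ?c bs @ normal_word bs ?c as) = mon ((edge_word as @ [Vgen ?c]) @ star_word bs @ edge_word bs @ Vgen ?c # star_word as)"
    by (simp add: normal_word_def)
  also have "\<dots> = mon (edge_word as @ Vgen ?c # Vgen ?b # Vgen ?c # star_word as)"
    by (subst mon_star_edge_word) (use assms g v in auto)
  also have "\<dots> = mon (edge_word as @ Vgen ?c # star_word as)"
    using mon_PP_context[of ?c ?b "edge_word as" "Vgen ?c # star_word as"] mon_PP_context[of ?c ?c "edge_word as" "star_word as"] g v c
    by simp
  finally show ?thesis by (simp add: normal_word_def)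
qed

section \<open>The local unit of each degree\<close>

definition reduced_factorization :: "('e \<times> bool) list \<Rightarrow> 'e list \<Rightarrow> 'e list \<Rightarrow> bool" where
  "reduced_factorization t as bs \<longleftrightarrow>
     no_common_last as bs \<and> epath as \<and> epath bs \<and> t = pos as @ neg bs"

text \<open>The definite description is meaningful because the factorization is unique. A degree
  without one has component zero, for which zero is the local unit.\<close>

definition eps :: "('e \<times> bool) list \<Rightarrow> (('v, 'e) generator list \<Rightarrow>\<^sub>0 'r) set" where
  "eps t = (if \<exists>as bs. reduced_factorization t as bs
     then THE x. \<exists>as bs. reduced_factorization t as bs \<and> x = mon (normal_word as (corner as bs) as)
     else \<zero>\<^bsub>L\<^esub>)"

lemma eps_eq:
  assumes "reduced_factorization t as bs"
  shows "eps t = mon (normal_word as (corner as bs) as)"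
proof -
  have "(THE x. \<exists>as bs. reduced_factorization t as bs \<and> x = mon (normal_word as (corner as bs) as)) =
      mon (normal_word as (corner as bs) as)"
    using assms by (intro the_equality) (auto simp: reduced_factorization_def dest!: pos_neg_inject)
  then show ?thesis using assms unfolding eps_def by auto
qed

lemma reduced_factorization_inv:
  "reduced_factorization t as bs \<Longrightarrow> reduced_factorization (rev (map inv_letter t)) bs as"
  by (auto simp: reduced_factorization_def no_common_last_commute rev_inv_pos)
    (simp add: pos_def neg_def rev_map inv_letter_def comp_def)

lemma eps_closed: "eps t \<in> carrier L"
proof (cases "\<exists>as bs. reduced_factorization t as bs")
  case True
  then obtain as bs where fac: "reduced_factorization t as bs" by blast
  then show ?thesis
    unfolding eps_eq[OF fac]
    by (intro mon_closed set_normal_word) (simp_all add: reduced_factorization_def corner_in_gen_verts)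
qed (simp add: eps_def)

lemma mult_zero:
  assumes "x \<in> carrier L"
  shows "x \<otimes>\<^bsub>L\<^esub> \<zero>\<^bsub>L\<^esub> = \<zero>\<^bsub>L\<^esub>" "\<zero>\<^bsub>L\<^esub> \<otimes>\<^bsub>L\<^esub> x = \<zero>\<^bsub>L\<^esub>"
  using assms by (auto simp: L_carrier L_zero L_mult)

text \<open>By linearity it is enough to test words, which are zero or normal. Inverting the degree
  swaps \<alpha> and \<beta>, so the right unit is the one of \<open>mon_right_unit\<close>.\<close>

lemma eps_unit:
  assumes "s \<in> cls ` homs t"
  shows "eps t \<otimes>\<^bsub>L\<^esub> s = s \<and> s \<otimes>\<^bsub>L\<^esub> eps (rev (map inv_letter t)) = s"
proof -
  obtain a where a: "a \<in> FA" "homogeneous t a" "s = cls a" using assms by (auto simp: homs_def)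
  have "eps t \<otimes>\<^bsub>L\<^esub> cls a = cls a \<and> cls a \<otimes>\<^bsub>L\<^esub> eps (rev (map inv_letter t)) = cls a"
  proof (rule fixed_by_left_right[OF eps_closed eps_closed a(1)])
    fix w assume w: "w \<in> Poly_Mapping.keys a" "w \<noteq> []" "set w \<subseteq> generators G"
    have "word_degree w = t" using a(2) w(1) by (simp add: homogeneous_def)
    then consider "mon w = \<zero>\<^bsub>L\<^esub>" | "mon w \<in> normal_forms t"
      using normal_or_zero[OF w(2,3)] by auto
    then show "eps t \<otimes>\<^bsub>L\<^esub> mon w = mon w \<and> mon w \<otimes>\<^bsub>L\<^esub> eps (rev (map inv_letter t)) = mon w"
    proof cases
      case 1
      then show ?thesis by (simp add: mult_zero eps_closed)
    next
      case 2
      then obtain as A bs where norm: "epath as" "epath bs" "A \<in> gen_verts G" "mon w = mon (normal_word as A bs)"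
        "foldr push_letter (pos as) (neg bs) = t"
        unfolding normal_forms_def by auto
      obtain as0 bs0 cs where split: "as = as0 @ cs" "bs = bs0 @ cs" "no_common_last as0 bs0"
        using split_common_suffix[of as bs] by auto
      \<comment> \<open>A normal word of degree \<open>t\<close> thus provides a factorization of
        \<open>t\<close>, so \<open>eps t\<close> does not take its default value here.\<close>
      then have fac: "reduced_factorization t as0 bs0"
        using norm foldr_push_pos_neg[OF split(3)] by (simp add: reduced_factorization_def epath_append)
      have p: "epath as0" "epath bs0" using norm split by (simp_all add: epath_append)
      show ?thesis
        unfolding eps_eq[OF fac] eps_eq[OF reduced_factorization_inv[OF fac]] norm(4)
        using norm(1-3) p mon_left_unit[of as0 cs bs0 A] mon_right_unit[of as0 cs bs0 A] split
        by (simp add: mon_mult set_normal_word corner_in_gen_verts)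
    qed
  qed
  then show ?thesis using a by simp
qed

lemma eps_in_ideal_prod:
  "eps t \<in> ideal_prod L (cls ` homs t) (cls ` homs (rev (map inv_letter t)))"
proof (cases "\<exists>as bs. reduced_factorization t as bs")
  case True
  then obtain as bs where fac: "reduced_factorization t as bs" by blast
  then have p: "epath as" "epath bs" "no_common_last as bs" "t = pos as @ neg bs"
    "rev (map inv_letter t) = pos bs @ neg as"
    using reduced_factorization_inv[OF fac] by (auto simp: reduced_factorization_def)
  let ?x = "normal_word as (corner as bs) bs" and ?y = "normal_word bs (corner as bs) as"
  have xy: "set ?x \<subseteq> generators G" "set ?y \<subseteq> generators G"
    using p by (simp_all add: set_normal_word corner_in_gen_verts)
  have "mon ?x \<in> cls ` homs t" "mon ?y \<in> cls ` homs (rev (map inv_letter t))"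
    using xy p foldr_push_pos_neg[of as bs "[]"] foldr_push_pos_neg[of bs as "[]"]
    by (auto intro!: mon_in_homs simp: word_degree_normal_word no_common_last_commute)
  then have "mon ?x \<otimes>\<^bsub>L\<^esub> mon ?y \<in> ideal_prod L (cls ` homs t) (cls ` homs (rev (map inv_letter t)))"
    by (rule ideal_prod.prod)
  moreover have "mon ?x \<otimes>\<^bsub>L\<^esub> mon ?y = eps t"
    using xy mon_corner_mult[OF p(1,2)] by (simp add: eps_eq[OF fac] mon_mult)
  ultimately show ?thesis by simp
next
  case False
  \<comment> \<open>The default value zero is a product of two zeros, which lie in every
    component.\<close>
  have "\<zero>\<^bsub>L\<^esub> \<in> cls ` homs u" for u unfolding L_zero by (rule imageI) (simp add: homs_def)
  then have "\<zero>\<^bsub>L\<^esub> \<otimes>\<^bsub>L\<^esub> \<zero>\<^bsub>L\<^esub> \<in> ideal_prod L (cls ` homs t) (cls ` homs (rev (map inv_letter t)))"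
    by (intro ideal_prod.prod)
  then show ?thesis using False by (simp add: eps_def mult_zero)
qed

lemma epsilon_strongly_graded_lpa:
  "epsilon_strongly_graded (free_group (edges G)) L (lpa_component R G)"
  unfolding group_grading.epsilon_strongly_graded_iff[OF group_grading_lpa] lpa_component_eq
  by (intro exI[of _ eps] ballI conjI)
    (simp_all only: inv_free_group eps_in_ideal_prod eps_unit)

end

theorem corollary6p6:
  fixes G :: "('v, 'e) pre_ultragraph"
  assumes "ultragraph G" and "edges G \<noteq> {}"
  shows "epsilon_strongly_graded (free_group (edges G))
           (leavitt_path_algebra TYPE('r::{comm_ring, comm_monoid_mult}) G)
           (lpa_component TYPE('r) G)
         \<longleftrightarrow> unital (leavitt_path_algebra TYPE('r) G)"
proof -
  interpret ultragraph_algebra G "TYPE('r)"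
    using assms(1) by (rule ultragraph_algebra.intro)
  show ?thesis
  proof
    assume "unital L"
    then obtain X where "unital_ultragraph_algebra TYPE('r) G X"
      using unital_imp_vertex_unit unital_ultragraph_algebra.intro[OF ultragraph_algebra_axioms]
        unital_ultragraph_algebra_axioms.intro by metis
    then show "epsilon_strongly_graded (free_group (edges G)) L (lpa_component TYPE('r) G)"
      by (rule unital_ultragraph_algebra.epsilon_strongly_graded_lpa)
  qed (rule epsilon_strongly_graded_imp_unital)
qed

end
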